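(* (Generalized Morley's Omitting Types Theorem) Let $\mathcal{K}$ be an ordered abstract class with a bigness notion $\mathbf{big}$. If $\mathcal{K}$ is a combinatorial Erdős–Rado class witnessed by $F:\mathrm{Card}\times\omega\to\mathrm{Card}$, then $\mathcal{K}$ is a cofinally Erdős–Rado class witnessed by the function $f^{\mathcal{K},F}$; that is, $\mathcal{K}$ is cofinally $(\mu,f^{\mathcal{K},F}(\mu),\mathbf{big})$-Erdős–Rado for every cardinal $\mu$.
   Context: **Abstract classes and types.** An abstract class $\mathcal{K}$ is a class of structures in a fixed language $\tau(\mathcal{K})$ with a partial order $\leq_{\mathcal{K}}$ contained in the substructure relation, such that membership and $\leq_{\mathcal{K}}$ respect isomorphism. A $\mathcal{K}$-embedding $f:M\to N$ is an injection preserving and reflecting atomic formulas with $f(M)\leq_{\mathcal{K}}N$. $\mathcal{K}$ is ordered if $\tau(\mathcal{K})$ has a distinguished binary relation $<$ that is a total order in every member. For finite tuples $\mathbf{a}_1\in I_1$, $\mathbf{a}_2\in I_2$ (with $I_1,I_2\in\mathcal{K}$), they have the same $\mathcal{K}$-type iff there are $J_1,\dots,J_n, I_1^*,\dots,I_{n+1}^*\in\mathcal{K}$, tuples $\mathbf{b}_\ell\in I^*_\ell$ and $\mathcal{K}$-embeddings $f_\ell:I^*_{\ell+1}\to J_\ell$ with $I_1^*=I_1$, $I_{n+1}^*=I_2$, $\mathbf{b}_1=\mathbf{a}_1$, $\mathbf{b}_{n+1}=\mathbf{a}_2$, $I_\ell^*\leq_{\mathcal{K}}J_\ell$, and $\mathbf{b}_\ell=f_\ell(\mathbf{b}_{\ell+1})$.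 The equivalence class is $tp_{\mathcal{K}}(\mathbf{a};I)$. $S^n_{\mathcal{K}}$ is the set of $\mathcal{K}$-types of $n$-tuples, $S^{inc,n}_{\mathcal{K}}$ those of tuples $a_1<\dots<a_n$, and $S_{\mathcal{K}}=\bigcup_n S^n_{\mathcal{K}}$, $S^{inc}_{\mathcal{K}}=\bigcup_n S^{inc,n}_{\mathcal{K}}$. For $p=tp_{\mathcal{K}}(i_1,\dots,i_n;I)$ and a set $s=\{k_1<\dots<k_m\}$ of indices, $p^s=tp_{\mathcal{K}}(i_{k_1},\dots,i_{k_m};I)$. For a language $\tau$, $\mathbb{K}^\tau$ is the abstract class of all $\tau$-structures with substructure; $tp_\tau$ and $S_\tau$ are types in this class (equivalently, quantifier-free types). **Bigness.** A bigness notion for $\mathcal{K}$ is a family of classes $\mathcal{K}_\mu\subseteq\mathcal{K}$ ($\mu$ a cardinal; members are called $\mu$-big) such that each $\mathcal{K}_\mu$ is nonempty; if $\mu_1\leq\mu_2$, $M\leq_{\mathcal{K}}N$ and $M\in\mathcal{K}_{\mu_2}$ then $N\in\mathcal{K}_{\mu_1}$; and every $M\in\mathcal{K}_{\aleph_0}$ realizes every type in $S_{\mathcal{K}}$. **Partition relation.** For $c:[I]^n\to\kappa$, $I_0\leq_{\mathcal{K}}I$ is type-homogeneous for $c$ iff there is $c^*:S^{inc,n}_{\mathcal{K}}\to\kappa$ with $c(\{i_1,\dots,i_n\})=c^*(tp_{\mathcal{K}}(i_1,\dots,i_n;I))$ for all $i_1<\dots<i_n$ in $I_0$. $(\lambda)\xrightarrow{\mathcal{K}}(\mu)^n_\kappa$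 means: for every $\lambda$-big $I\in\mathcal{K}$ and $c:[I]^n\to\kappa$ there is a $\mu$-big $I_0\leq_{\mathcal{K}}I$ type-homogeneous for $c$. $\mathcal{K}$ is a combinatorial Erdős–Rado class witnessed by $F:\mathrm{Card}\times\omega\to\mathrm{Card}$ iff $(F(\mu,n))\xrightarrow{\mathcal{K}}(\mu)^n_\kappa$ for all cardinals $\kappa<\mu$ and $n<\omega$. **Blueprints.** A blueprint $\Phi$ proper for $\mathcal{K}$ is a function $\Phi:S^{inc}_{\mathcal{K}}\to S_\tau$, for some language $\tau=\tau(\Phi)$, sending $n$-types to $n$-types (same free variables) with $\Phi(p^s)=\Phi(p)^s$ for all $p\in S^{inc,n}_{\mathcal{K}}$, $s\subseteq n$. **Cofinal Erdős–Rado classes.** $\mathcal{K}$ is cofinally $(\mu,\chi,\mathbf{big})$-Erdős–Rado iff for every language $\tau$ with $|\tau|\leq\mu$: whenever for each cardinal $\alpha<\chi$ we have a $\tau$-structure $M_\alpha$, an $\alpha$-big $I_\alpha\in\mathcal{K}$ and an injection $f_\alpha:I_\alpha\to M_\alpha$, there is a blueprint $\Phi$ proper for $\mathcal{K}$ with $\tau(\Phi)=\tau$ such that for each $p\in S^{inc}_{\mathcal{K}}$ there are cofinally many $\alpha<\chi$ for which there are $i_1<\dots<i_n\in I_\alpha$ realizing $p$ with $tp_\tau(f_\alpha(i_1),\dots,f_\alpha(i_n);M_\alpha)=\Phi(p)$. **The function $f^{\mathcal{K},F}$.** Define $\daleth^F_0=\aleph_0$, $\daleth^F_{\alpha+1}=\sup_{n<\omega}F(\daleth^F_\alpha,n)$,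 $\daleth^F_\delta=\sup_{\alpha<\delta}\daleth^F_\alpha$ for limit $\delta$. Put $g^{\mathcal{K}}(\mu)=\sup_{n<\omega}2^{\mu\cdot|S^n_{\mathcal{K}}|}$ and $f^{\mathcal{K},F}(\mu)=\daleth^F_{g^{\mathcal{K}}(\mu)^+}$.
   Formalization: The formal version adds that $\daleth^F$ is strictly increasing (otherwise false: linear orders with $F(\aleph_0,n)=\aleph_0$), counts $|\tau|$ as the number of symbols plus $\aleph_0$, and works with the sets of an inaccessible universe. *)

theory Defs
  imports "HOL-Library.Equipollence"
begin

section \<open>Cardinals and ordinals\<close>

text \<open>
  HOL has no universe of all sets, so a well-ordered type \<open>'u\<close> plays that role.  Its elements
  are the ordinals, the ordinal \<open>a\<close> being identified with its set of predecessors \<open>{..<a}\<close>, and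
  the small sets are those that inject into some \<open>{..<a}\<close>.  The axioms of infinity, power set and
  replacement below say that the order type of \<open>'u\<close> is an uncountable strongly inaccessible
  cardinal, so that the small subsets of \<open>'u\<close> behave up to bijection as the sets of ZFC do,
  and arbitrary families of small objects behave as (arbitrary, not just definable) classes.
\<close>

definition set_universe :: "'u::wellorder itself \<Rightarrow> bool" where
  "set_universe _ \<longleftrightarrow>
     (\<exists>a::'u. infinite {..<a}) \<and>
     (\<forall>a::'u. \<exists>b::'u. Pow {..<a} \<lesssim> {..<b}) \<and>
     (\<forall>(a::'u) (f::'u \<Rightarrow> 'u). \<exists>b. \<forall>x<a. f x < b)"

definition small :: "'u::wellorder set \<Rightarrow> bool" where
  "small A \<longleftrightarrow> (\<exists>a::'u. A \<lesssim> {..<a})"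

text \<open>Cardinals are the initial ordinals.\<close>

definition is_card :: "'u::wellorder \<Rightarrow> bool" where
  "is_card a \<longleftrightarrow> (\<forall>b<a. {..<b} \<prec> {..<a})"

text \<open>Cardinality, meaningful for sets of any type that inject into some \<open>{..<a}\<close>.\<close>

definition crd :: "'b set \<Rightarrow> 'u::wellorder" where
  "crd A = (LEAST a. A \<lesssim> {..<a})"

definition aleph0 :: "'u::wellorder" where
  "aleph0 = (LEAST a. infinite {..<a})"

definition csucc :: "'u::wellorder \<Rightarrow> 'u" where
  "csucc a = (LEAST b. {..<a} \<prec> {..<b})"

definition ozero :: "'u::wellorder" where
  "ozero = (LEAST a. True)"

definition osuc :: "'u::wellorder \<Rightarrow> 'u" where
  "osuc a = (LEAST b. a < b)"

definition osup :: "'u::wellorder set \<Rightarrow> 'u" where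
  "osup A = (LEAST b. \<forall>a\<in>A. a \<le> b)"


section \<open>Structures\<close>

text \<open>
  A symbol is a pair of a name and an arity; the name may be any element of \<open>'u\<close>.
  Function symbols of arity 0 are the constants.
\<close>

record 'u lang =
  rsyms :: "('u \<times> nat) set"
  fsyms :: "('u \<times> nat) set"

text \<open>
  \<open>|\<tau>| \<le> \<mu>\<close>, with the model-theoretic convention that \<open>|\<tau>|\<close> is the number of symbols
  plus \<open>\<aleph>\<^sub>0\<close>.
\<close>

definition lang_card_le :: "'u::wellorder lang \<Rightarrow> 'u \<Rightarrow> bool" where
  "lang_card_le \<tau> \<mu> \<longleftrightarrow> infinite {..<\<mu>} \<and> rsyms \<tau> <+> fsyms \<tau> \<lesssim> {..<\<mu>}"

record 'u struct =
  univ :: "'u set"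
  rel :: "'u \<times> nat \<Rightarrow> 'u list \<Rightarrow> bool"
  fn :: "'u \<times> nat \<Rightarrow> 'u list \<Rightarrow> 'u"

text \<open>
  The interpretations are fixed outside their proper domain (to \<open>False\<close> and \<open>undefined\<close>), so that
  HOL equality of structures is equality of structures.
\<close>

definition is_struct :: "'u::wellorder lang \<Rightarrow> 'u struct \<Rightarrow> bool" where
  "is_struct \<tau> M \<longleftrightarrow>
     small (univ M) \<and>
     (\<forall>r xs. rel M r xs \<longrightarrow> r \<in> rsyms \<tau> \<and> length xs = snd r \<and> set xs \<subseteq> univ M) \<and>
     (\<forall>g xs. if g \<in> fsyms \<tau> \<and> length xs = snd g \<and> set xs \<subseteq> univ M
             then fn M g xs \<in> univ M else fn M g xs = undefined)"

definition induced :: "'u struct \<Rightarrow> 'u set \<Rightarrow> 'u struct" where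
  "induced N A = \<lparr>univ = A,
                  rel = (\<lambda>r xs. rel N r xs \<and> set xs \<subseteq> A),
                  fn = (\<lambda>g xs. if set xs \<subseteq> A then fn N g xs else undefined)\<rparr>"

definition substructure :: "'u::wellorder lang \<Rightarrow> 'u struct \<Rightarrow> 'u struct \<Rightarrow> bool" where
  "substructure \<tau> M N \<longleftrightarrow>
     is_struct \<tau> M \<and> is_struct \<tau> N \<and> univ M \<subseteq> univ N \<and> M = induced N (univ M)"

text \<open>Injections preserving and reflecting atomic formulas.\<close>

definition embedding ::
    "'u::wellorder lang \<Rightarrow> ('u \<Rightarrow> 'u) \<Rightarrow> 'u struct \<Rightarrow> 'u struct \<Rightarrow> bool" where
  "embedding \<tau> h M N \<longleftrightarrow>
     is_struct \<tau> M \<and> is_struct \<tau> N \<and> inj_on h (univ M) \<and> h ` univ M \<subseteq> univ N \<and>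
     (\<forall>r\<in>rsyms \<tau>. \<forall>xs. length xs = snd r \<and> set xs \<subseteq> univ M \<longrightarrow>
        (rel M r xs \<longleftrightarrow> rel N r (map h xs))) \<and>
     (\<forall>g\<in>fsyms \<tau>. \<forall>xs. length xs = snd g \<and> set xs \<subseteq> univ M \<longrightarrow>
        h (fn M g xs) = fn N g (map h xs))"

definition iso ::
    "'u::wellorder lang \<Rightarrow> ('u \<Rightarrow> 'u) \<Rightarrow> 'u struct \<Rightarrow> 'u struct \<Rightarrow> bool" where
  "iso \<tau> h M N \<longleftrightarrow> embedding \<tau> h M N \<and> h ` univ M = univ N"


section \<open>Abstract classes and types\<close>

record 'u aclass =
  lng :: "'u lang"
  mem :: "'u struct set"
  le :: "'u struct \<Rightarrow> 'u struct \<Rightarrow> bool"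

definition abstract_class :: "'u::wellorder aclass \<Rightarrow> bool" where
  "abstract_class K \<longleftrightarrow>
     (\<exists>\<mu>. lang_card_le (lng K) \<mu>) \<and>
     (\<forall>M\<in>mem K. is_struct (lng K) M) \<and>
     (\<forall>M N. le K M N \<longrightarrow> M \<in> mem K \<and> N \<in> mem K \<and> substructure (lng K) M N) \<and>
     (\<forall>M\<in>mem K. le K M M) \<and>
     (\<forall>M N. le K M N \<and> le K N M \<longrightarrow> M = N) \<and>
     (\<forall>M N P. le K M N \<and> le K N P \<longrightarrow> le K M P) \<and>
     (\<forall>h M M'. M \<in> mem K \<and> iso (lng K) h M M' \<longrightarrow> M' \<in> mem K) \<and>
     (\<forall>h M N M' N'. le K M N \<and> iso (lng K) h N N' \<and> iso (lng K) h M M' \<longrightarrow> le K M' N')"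

definition K_embedding ::
    "'u::wellorder aclass \<Rightarrow> ('u \<Rightarrow> 'u) \<Rightarrow> 'u struct \<Rightarrow> 'u struct \<Rightarrow> bool" where
  "K_embedding K h M N \<longleftrightarrow>
     M \<in> mem K \<and> N \<in> mem K \<and> embedding (lng K) h M N \<and> le K (induced N (h ` univ M)) N"

definition ordered_class :: "'u::wellorder aclass \<Rightarrow> 'u \<times> nat \<Rightarrow> bool" where
  "ordered_class K lt \<longleftrightarrow>
     abstract_class K \<and> lt \<in> rsyms (lng K) \<and> snd lt = 2 \<and>
     (\<forall>M\<in>mem K.
        (\<forall>x\<in>univ M. \<not> rel M lt [x, x]) \<and>
        (\<forall>x\<in>univ M. \<forall>y\<in>univ M. \<forall>z\<in>univ M.
           rel M lt [x, y] \<and> rel M lt [y, z] \<longrightarrow> rel M lt [x, z]) \<and>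
        (\<forall>x\<in>univ M. \<forall>y\<in>univ M. x \<noteq> y \<longrightarrow> rel M lt [x, y] \<or> rel M lt [y, x]))"

text \<open>The abstract class of all \<open>\<tau>\<close>-structures with the substructure relation.\<close>

definition all_structs :: "'u::wellorder lang \<Rightarrow> 'u aclass" where
  "all_structs \<tau> = \<lparr>lng = \<tau>, mem = {M. is_struct \<tau> M}, le = substructure \<tau>\<rparr>"

text \<open>Finite tuples in a structure, with the structure; a type is an equivalence class of these.\<close>

type_synonym 'u pointed = "'u struct \<times> 'u list"

definition tuple_in :: "'u aclass \<Rightarrow> 'u struct \<Rightarrow> 'u list \<Rightarrow> bool" where
  "tuple_in K I a \<longleftrightarrow> I \<in> mem K \<and> set a \<subseteq> univ I"

text \<open>
  One link \<open>I\<^sub>\<ell> \<le> J\<^sub>\<ell>\<close>, \<open>f\<^sub>\<ell> : I\<^sub>\<ell>\<^sub>+\<^sub>1 \<rightarrow> J\<^sub>\<ell>\<close>, \<open>b\<^sub>\<ell> = f\<^sub>\<ell>(b\<^sub>\<ell>\<^sub>+\<^sub>1)\<close> of the chains that define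
  equality of types.
\<close>

definition type_link :: "'u::wellorder aclass \<Rightarrow> 'u pointed \<Rightarrow> 'u pointed \<Rightarrow> bool" where
  "type_link K = (\<lambda>(I, a) (I', b).
     tuple_in K I a \<and> tuple_in K I' b \<and>
     (\<exists>J f. le K I J \<and> K_embedding K f I' J \<and> a = map f b))"

definition tp :: "'u::wellorder aclass \<Rightarrow> 'u list \<Rightarrow> 'u struct \<Rightarrow> 'u pointed set" where
  "tp K a I = {q. (type_link K)\<^sup>+\<^sup>+ (I, a) q}"

definition realizes ::
    "'u::wellorder aclass \<Rightarrow> 'u struct \<Rightarrow> 'u list \<Rightarrow> 'u pointed set \<Rightarrow> bool" where
  "realizes K I a p \<longleftrightarrow> tuple_in K I a \<and> tp K a I = p"

definition types :: "'u::wellorder aclass \<Rightarrow> nat \<Rightarrow> 'u pointed set set" where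
  "types K n = {tp K a I | a I. tuple_in K I a \<and> length a = n}"

definition increasing :: "'u \<times> nat \<Rightarrow> 'u struct \<Rightarrow> 'u list \<Rightarrow> bool" where
  "increasing lt I a \<longleftrightarrow> set a \<subseteq> univ I \<and> sorted_wrt (\<lambda>x y. rel I lt [x, y]) a"

definition inc_types ::
    "'u::wellorder aclass \<Rightarrow> 'u \<times> nat \<Rightarrow> nat \<Rightarrow> 'u pointed set set" where
  "inc_types K lt n = {tp K a I | a I. I \<in> mem K \<and> increasing lt I a \<and> length a = n}"

text \<open>
  \<open>p\<^sup>s\<close>, with indices counted from 0.  The type links are preserved by passing to subtuples,
  so the description is proper for every type \<open>p\<close>.
\<close>

definition subtype :: "'u::wellorder aclass \<Rightarrow> 'u pointed set \<Rightarrow> nat set \<Rightarrow> 'u pointed set" where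
  "subtype K p s = (THE q. \<exists>I a. realizes K I a p \<and> q = tp K (nths a s) I)"


section \<open>Bigness and Erdos--Rado classes\<close>

definition bigness :: "'u::wellorder aclass \<Rightarrow> ('u \<Rightarrow> 'u struct set) \<Rightarrow> bool" where
  "bigness K big \<longleftrightarrow>
     (\<forall>\<mu>. is_card \<mu> \<longrightarrow> big \<mu> \<subseteq> mem K \<and> big \<mu> \<noteq> {}) \<and>
     (\<forall>\<mu>1 \<mu>2 M N. is_card \<mu>1 \<and> is_card \<mu>2 \<and> \<mu>1 \<le> \<mu>2 \<and> le K M N \<and> M \<in> big \<mu>2 \<longrightarrow> N \<in> big \<mu>1) \<and>
     (\<forall>M\<in>big aleph0. \<forall>n. \<forall>p\<in>types K n. \<exists>a. realizes K M a p)"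

definition type_homogeneous ::
    "'u::wellorder aclass \<Rightarrow> 'u \<times> nat \<Rightarrow> nat \<Rightarrow> 'u \<Rightarrow> 'u struct \<Rightarrow> ('u set \<Rightarrow> 'u) \<Rightarrow> 'u struct \<Rightarrow> bool"
  where
  "type_homogeneous K lt n \<kappa> I c I0 \<longleftrightarrow>
     (\<exists>c'. (\<forall>p\<in>inc_types K lt n. c' p < \<kappa>) \<and>
           (\<forall>a. increasing lt I0 a \<and> length a = n \<longrightarrow> c (set a) = c' (tp K a I)))"

definition arrows ::
    "'u::wellorder aclass \<Rightarrow> 'u \<times> nat \<Rightarrow> ('u \<Rightarrow> 'u struct set) \<Rightarrow> 'u \<Rightarrow> 'u \<Rightarrow> nat \<Rightarrow> 'u \<Rightarrow> bool" where
  "arrows K lt big \<theta> \<mu> n \<kappa> \<longleftrightarrow>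
     (\<forall>I\<in>big \<theta>. \<forall>c.
        (\<forall>X. X \<subseteq> univ I \<and> finite X \<and> card X = n \<longrightarrow> c X < \<kappa>) \<longrightarrow>
        (\<exists>I0\<in>big \<mu>. le K I0 I \<and> type_homogeneous K lt n \<kappa> I c I0))"

definition combinatorial_ER ::
    "'u::wellorder aclass \<Rightarrow> 'u \<times> nat \<Rightarrow> ('u \<Rightarrow> 'u struct set) \<Rightarrow> ('u \<Rightarrow> nat \<Rightarrow> 'u) \<Rightarrow> bool" where
  "combinatorial_ER K lt big F \<longleftrightarrow>
     (\<forall>\<mu> n. is_card \<mu> \<longrightarrow> is_card (F \<mu> n)) \<and>
     (\<forall>\<mu> \<kappa> n. is_card \<mu> \<and> is_card \<kappa> \<and> \<kappa> < \<mu> \<longrightarrow> arrows K lt big (F \<mu> n) \<mu> n \<kappa>)"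

definition blueprint ::
    "'u::wellorder aclass \<Rightarrow> 'u \<times> nat \<Rightarrow> 'u lang \<Rightarrow> ('u pointed set \<Rightarrow> 'u pointed set) \<Rightarrow> bool" where
  "blueprint K lt \<tau> \<Phi> \<longleftrightarrow>
     (\<forall>n. \<forall>p\<in>inc_types K lt n.
        \<Phi> p \<in> types (all_structs \<tau>) n \<and>
        (\<forall>s\<subseteq>{..<n}. \<Phi> (subtype K p s) = subtype (all_structs \<tau>) (\<Phi> p) s))"

definition cofinally_ER ::
    "'u::wellorder aclass \<Rightarrow> 'u \<times> nat \<Rightarrow> ('u \<Rightarrow> 'u struct set) \<Rightarrow> 'u \<Rightarrow> 'u \<Rightarrow> bool" where
  "cofinally_ER K lt big \<mu> \<chi> \<longleftrightarrow>
     (\<forall>\<tau> M I f.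
        lang_card_le \<tau> \<mu> \<and>
        (\<forall>\<alpha><\<chi>. is_card \<alpha> \<longrightarrow>
           is_struct \<tau> (M \<alpha>) \<and> I \<alpha> \<in> big \<alpha> \<and>
           inj_on (f \<alpha>) (univ (I \<alpha>)) \<and> f \<alpha> ` univ (I \<alpha>) \<subseteq> univ (M \<alpha>)) \<longrightarrow>
        (\<exists>\<Phi>. blueprint K lt \<tau> \<Phi> \<and>
           (\<forall>n. \<forall>p\<in>inc_types K lt n. \<forall>\<beta><\<chi>. is_card \<beta> \<longrightarrow>
              (\<exists>\<alpha>. is_card \<alpha> \<and> \<beta> \<le> \<alpha> \<and> \<alpha> < \<chi> \<and>
                 (\<exists>a. increasing lt (I \<alpha>) a \<and> realizes K (I \<alpha>) a p \<and>
                      tp (all_structs \<tau>) (map (f \<alpha>) a) (M \<alpha>) = \<Phi> p)))))"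


section \<open>The functions \<open>\<daleth>\<^sup>F\<close>, \<open>g\<close> and \<open>f\<close>\<close>

lemma osuc_pred_unique:
  fixes \<alpha> :: "'u::wellorder"
  assumes "\<beta> < \<alpha>" "\<alpha> = osuc \<beta>"
  shows "(THE \<beta>. \<beta> < \<alpha> \<and> \<alpha> = osuc \<beta>) = \<beta>"
proof (rule the_equality)
  fix \<gamma> assume \<gamma>: "\<gamma> < \<alpha> \<and> \<alpha> = osuc \<gamma>"
  have "\<not> \<beta> < \<gamma>" "\<not> \<gamma> < \<beta>"
    using assms \<gamma> not_less_Least unfolding osuc_def by metis+
  then show "\<gamma> = \<beta>" by auto
qed (use assms in auto)

text \<open>
  The word "hierarchy" suggests that \<open>\<daleth>\<^sup>F\<close> increases, but a witness \<open>F\<close> of the combinatorial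
  property need not make it do so: for linear orders with \<open>\<mu>\<close>-big meaning of size at least \<open>\<mu>\<close>,
  Ramsey's theorem allows \<open>F \<aleph>\<^sub>0 n = \<aleph>\<^sub>0\<close>, and then \<open>\<daleth>\<^sup>F\<close> is constantly \<open>\<aleph>\<^sub>0\<close>.
  Strict increase has to be assumed where it is needed.
\<close>

function daleth :: "('u::wellorder \<Rightarrow> nat \<Rightarrow> 'u) \<Rightarrow> 'u \<Rightarrow> 'u" where
  "daleth F \<alpha> =
     (if \<alpha> = ozero then aleph0
      else if \<exists>\<beta><\<alpha>. \<alpha> = osuc \<beta>
        then osup (range (\<lambda>n. F (daleth F (THE \<beta>. \<beta> < \<alpha> \<and> \<alpha> = osuc \<beta>)) n))
      else osup ((\<lambda>\<beta>. daleth F \<beta>) ` {..<\<alpha>}))"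
  by auto
termination
  by (relation "inv_image {(x, y). x < y} snd") (auto simp: wf osuc_pred_unique)

declare daleth.simps [simp del]

definition g_fun :: "'u::wellorder aclass \<Rightarrow> 'u \<Rightarrow> 'u" where
  "g_fun K \<mu> = osup (range (\<lambda>n. crd (Pow ({..<\<mu>} \<times> types K n))))"

definition f_fun :: "'u::wellorder aclass \<Rightarrow> ('u \<Rightarrow> nat \<Rightarrow> 'u) \<Rightarrow> 'u \<Rightarrow> 'u" where
  "f_fun K F \<mu> = daleth F (csucc (g_fun K \<mu>))"

text \<open>The recursion equations of \<open>\<daleth>\<^sup>F\<close>.\<close>

lemma less_osuc:
  assumes "set_universe TYPE('u::wellorder)"
  shows "(\<beta>::'u) < osuc \<beta>"
proof -
  obtain a :: 'u where "infinite {..<a}"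
    using assms unfolding set_universe_def by blast
  then obtain x where "x < a"
    by (metis finite.emptyI ex_in_conv lessThan_iff)
  moreover have "\<forall>(a::'u) (f::'u \<Rightarrow> 'u). \<exists>b. \<forall>x<a. f x < b"
    using assms unfolding set_universe_def by simp
  then have "\<exists>b. \<forall>x<a. (\<lambda>_. \<beta>) x < b"
    by (elim allE)
  ultimately have "\<exists>b. \<beta> < b"
    by blast
  then show ?thesis
    unfolding osuc_def by (rule LeastI_ex)
qed

lemma daleth_ozero: "daleth F ozero = aleph0"
  by (subst daleth.simps) simp

lemma daleth_osuc:
  assumes "set_universe TYPE('u::wellorder)"
  shows "daleth F (osuc (\<beta>::'u)) = osup (range (F (daleth F \<beta>)))"
proof -
  have lt: "\<beta> < osuc \<beta>" by (rule less_osuc[OF assms])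
  have "ozero \<le> \<beta>" unfolding ozero_def by (simp add: Least_le)
  with lt have "osuc \<beta> \<noteq> ozero" by auto
  with lt show ?thesis
    by (subst daleth.simps) (auto simp: osuc_pred_unique)
qed

lemma daleth_limit:
  assumes "\<delta> \<noteq> ozero" "\<forall>\<beta><\<delta>. \<delta> \<noteq> osuc \<beta>"
  shows "daleth F \<delta> = osup (daleth F ` {..<\<delta>})"
  using assms by (subst daleth.simps) auto

end

theory Submission
  imports Defs
begin

text \<open>
  Write \<open>g\<close> for \<open>g_fun K \<mu>\<close> and \<open>\<chi>\<close> for \<open>f_fun K F \<mu>\<close>, so that \<open>\<chi>\<close> is the supremum of the
  strictly increasing sequence of \<open>\<daleth>\<^sup>F\<^sub>\<zeta>\<close> with \<open>\<zeta> < g\<^sup>+\<close>.  The blueprint is built one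
  tuple length at a time, as in Morley's omitting types theorem.  At each stage there is a family,
  indexed by \<open>\<zeta> < g\<^sup>+\<close>, of \<open>\<daleth>\<^sup>F\<^sub>\<zeta>\<close>-big structures \<open>J\<^sub>\<zeta>\<close>, each lying below some given
  \<open>I\<^sub>\<alpha>\<close> with \<open>\<daleth>\<^sup>F\<^sub>\<zeta> \<le> \<alpha> < \<chi>\<close>; at first, \<open>J\<^sub>\<zeta>\<close> is \<open>I\<^sub>\<alpha>\<close> for \<open>\<alpha> = \<daleth>\<^sup>F\<^sub>\<zeta>\<close>.

  Stage \<open>n\<close> colours an increasing \<open>n\<close>-tuple of \<open>J\<^sub>\<zeta>\<close> by the quantifier-free type of its image.
  There are at most \<open>2\<^sup>\<mu>\<close> colours (\<open>types_all_structs_lepoll\<close>), so for \<open>\<zeta>\<close> beyond that cardinal the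
  partition relation, applied to a member that is one step higher in the hierarchy, yields a
  \<open>\<daleth>\<^sup>F\<^sub>\<zeta>\<close>-big substructure in which the type of a tuple determines its colour
  (\<open>homogenise_member\<close>).  The resulting map from increasing \<open>n\<close>-types to quantifier-free types depends
  on \<open>\<zeta>\<close>, but there are at most \<open>2\<close> to the \<open>\<mu> \<cdot> |S\<^sup>n|\<close>, hence at most \<open>g\<close>, such maps; as \<open>g\<^sup>+\<close> is
  regular, one map occurs for unboundedly many \<open>\<zeta>\<close> (\<open>unbounded_fibre\<close>), and reindexing by those gives
  the next family (\<open>homogenise_family\<close>).

  The maps chosen at the stages together form \<open>\<Phi>\<close>.  Every big structure realizes every type, so
  in the family after stage \<open>n\<close> each increasing \<open>n\<close>-type is realized, in structures below
  \<open>I\<^sub>\<alpha>\<close> for cofinally many \<open>\<alpha>\<close>, by a tuple all of whose subtuples have been homogenised.  Such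
  tuples witness both the coherence of \<open>\<Phi>\<close> with subtypes and the cofinal realization
  (\<open>blueprint_exists\<close>).
\<close>

section \<open>Cardinal arithmetic\<close>

lemma lepoll_iff_ordLeq: "A \<lesssim> B \<longleftrightarrow> (card_of A, card_of B) \<in> ordLeq"
  by (simp add: lepoll_def card_of_ordLeq)

lemma not_lesspoll_imp_lepoll: "\<not> A \<prec> B \<Longrightarrow> B \<lesssim> A"
  by (metis eqpoll_imp_lepoll eqpoll_sym lepoll_iff_leqpoll lepoll_iff_ordLeq card_of_Well_order
      ordLeq_total)

lemma UN_lepoll_infinite:
  assumes "infinite C" "I \<lesssim> C" "\<And>i. i \<in> I \<Longrightarrow> A i \<lesssim> C"
  shows "(\<Union>i\<in>I. A i) \<lesssim> C"
  using card_of_UNION_ordLeq_infinite[of C I A] assms by (simp add: lepoll_iff_ordLeq)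

lemma Un_lepoll_infinite:
  assumes "infinite C" "A \<lesssim> C" "B \<lesssim> C"
  shows "A \<union> B \<lesssim> C"
proof -
  have "(\<Union>i\<in>{True,False}. if i then A else B) \<lesssim> C"
    using assms by (intro UN_lepoll_infinite) (auto intro: finite_lepoll_infinite)
  then show ?thesis by (simp add: Un_commute)
qed

lemma Times_lepoll_infinite:
  assumes "infinite C" "A \<lesssim> C" "B \<lesssim> C"
  shows "A \<times> B \<lesssim> C"
proof -
  have "(\<Union>x\<in>A. Pair x ` B) \<lesssim> C"
    using assms by (intro UN_lepoll_infinite) (auto intro: lepoll_trans image_lepoll)
  moreover have "(\<Union>x\<in>A. Pair x ` B) = A \<times> B" by auto
  ultimately show ?thesis by simp
qed

lemma Plus_lepoll_infinite:
  assumes "infinite C" "A \<lesssim> C" "B \<lesssim> C"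
  shows "A <+> B \<lesssim> C"
  unfolding Plus_def using assms
  by (intro Un_lepoll_infinite) (auto intro: lepoll_trans image_lepoll)

lemma lists_lepoll_infinite:
  assumes "infinite C" "A \<lesssim> C"
  shows "lists A \<lesssim> C"
proof -
  have "{xs \<in> lists A. length xs = n} \<lesssim> C" for n
  proof (induction n)
    case 0
    have "finite {xs \<in> lists A. length xs = 0}" by (rule finite_subset[of _ "{[]}"]) auto
    then show ?case using assms by (intro finite_lepoll_infinite)
  next
    case (Suc n)
    have "{xs \<in> lists A. length xs = Suc n}
        \<subseteq> (\<lambda>(x, xs). x # xs) ` (A \<times> {xs \<in> lists A. length xs = n})"
      by (auto simp: length_Suc_conv image_iff)
    then show ?case
      using Times_lepoll_infinite[OF assms Suc] by (meson lepoll_trans subset_image_lepoll)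
  qed
  then have "(\<Union>n::nat. {xs \<in> lists A. length xs = n}) \<lesssim> C"
    using assms by (intro UN_lepoll_infinite) (auto simp: infinite_le_lepoll[symmetric])
  moreover have "(\<Union>n::nat. {xs \<in> lists A. length xs = n}) = lists A" by auto
  ultimately show ?thesis by simp
qed

lemma Pow_lepoll_mono: "A \<lesssim> B \<Longrightarrow> Pow A \<lesssim> Pow B"
  unfolding lepoll_def by (metis image_Pow_mono inj_on_image_Pow)

section \<open>Cardinals and the hierarchy in a universe of sets\<close>

lemma lepoll_lessThan_mono: "a \<le> b \<Longrightarrow> {..<a} \<lesssim> {..<(b::'u::wellorder)}"
  by (simp add: subset_imp_lepoll)

lemma infinite_lessThan_mono:
  "infinite {..<a} \<Longrightarrow> a \<le> b \<Longrightarrow> infinite {..<(b::'u::wellorder)}"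
  by (meson finite_subset lessThan_subset_iff)

lemma ozero_le [simp]: "ozero \<le> a"
  unfolding ozero_def by (simp add: Least_le)

lemma osuc_le: "a < b \<Longrightarrow> osuc a \<le> b"
  unfolding osuc_def by (rule Least_le)

lemma less_osup: "x < osup (A :: 'u::wellorder set) \<Longrightarrow> \<exists>a\<in>A. x < a"
  unfolding osup_def using not_less_Least not_le by blast

lemma lepoll_crd: "A \<lesssim> {..<(a::'u::wellorder)} \<Longrightarrow> A \<lesssim> {..<crd A :: 'u}"
  unfolding crd_def by (rule LeastI)

lemma crd_le: "A \<lesssim> {..<(a::'u::wellorder)} \<Longrightarrow> crd A \<le> a"
  unfolding crd_def by (rule Least_le)

lemma is_card_crd:
  assumes "A \<lesssim> {..<(a::'u::wellorder)}"
  shows "is_card (crd A :: 'u)"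
  unfolding is_card_def
proof (intro allI impI)
  fix b :: 'u assume b: "b < crd A"
  have "\<not> {..<crd A :: 'u} \<lesssim> {..<b}"
    using b crd_le[of A b] lepoll_trans[OF lepoll_crd[OF assms], of "{..<b}"] by auto
  then show "{..<b} \<prec> {..<crd A :: 'u}"
    using not_lesspoll_imp_lepoll by blast
qed

lemma lessThan_lepoll_if_less_csucc: "b < csucc (a::'u::wellorder) \<Longrightarrow> {..<b} \<lesssim> {..<a}"
  unfolding csucc_def using not_less_Least not_lesspoll_imp_lepoll by blast

context
  assumes univ: "set_universe TYPE('u::wellorder)"
begin

lemma lessThan_osuc: "{..<osuc (a::'u)} = {..a}"
  using less_osuc[OF univ, of a] osuc_le[of a]
  by (auto simp: set_eq_iff) (meson not_le)

text \<open>
  This is replacement: a set that is the image of an initial segment is bounded, which makes the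
  suprema of small sets and of sequences genuine.
\<close>

lemma strict_upper_bound_lepoll:
  assumes "A \<lesssim> {..<(a::'u)}"
  shows "\<exists>b::'u. \<forall>x\<in>A. x < b"
proof -
  obtain g where g: "A \<subseteq> g ` {..<a}" using assms by (auto simp: lepoll_iff)
  have "\<forall>f::'u \<Rightarrow> 'u. \<exists>b. \<forall>x<a. f x < b"
    using univ unfolding set_universe_def by simp
  then obtain b where "\<forall>x<a. g x < b" by meson
  then show ?thesis using g by blast
qed

lemma le_osup: "small A \<Longrightarrow> x \<in> A \<Longrightarrow> x \<le> osup (A :: 'u set)"
proof -
  assume "small A" "x \<in> A"
  then obtain b where "\<forall>a\<in>A. a \<le> b"
    using strict_upper_bound_lepoll unfolding small_def by (meson less_imp_le)
  then have "\<forall>a\<in>A. a \<le> osup A" unfolding osup_def by (rule LeastI)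
  with \<open>x \<in> A\<close> show ?thesis by blast
qed

lemma infinite_aleph0: "infinite {..<aleph0 :: 'u}"
  unfolding aleph0_def by (rule LeastI_ex) (use univ in \<open>auto simp: set_universe_def\<close>)

lemma small_countable: "small (range (f :: nat \<Rightarrow> 'u))"
  unfolding small_def using infinite_aleph0
  by (meson image_lepoll infinite_le_lepoll lepoll_trans)

lemma is_card_aleph0: "is_card (aleph0 :: 'u)"
  unfolding is_card_def using infinite_aleph0 not_less_Least
  by (metis aleph0_def finite_lesspoll_infinite)

lemma is_card_osup:
  assumes "small A" "\<And>a. a \<in> A \<Longrightarrow> is_card a"
  shows "is_card (osup (A :: 'u set))"
  unfolding is_card_def
proof (intro allI impI)
  fix b assume "b < osup A"
  then obtain a where "a \<in> A" "b < a" using less_osup by blast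
  then show "{..<b} \<prec> {..<osup A}"
    using assms le_osup lepoll_lessThan_mono lesspoll_trans2 unfolding is_card_def by blast
qed

lemma Pow_lepoll_lessThan: "A \<lesssim> {..<(a::'u)} \<Longrightarrow> \<exists>b::'u. Pow A \<lesssim> {..<b}"
  using univ Pow_lepoll_mono lepoll_trans unfolding set_universe_def by blast

lemma lepoll_infinite_lessThan:
  assumes "A \<lesssim> {..<(a::'u)}"
  shows "\<exists>b::'u. infinite {..<b} \<and> A \<lesssim> {..<b} \<and> c \<le> b"
proof -
  have "a \<le> max a (max c aleph0)" "aleph0 \<le> max a (max c aleph0)" "c \<le> max a (max c aleph0)"
    by (auto simp: le_max_iff_disj)
  then show ?thesis
    using assms infinite_aleph0 infinite_lessThan_mono lepoll_lessThan_mono lepoll_trans by meson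
qed

lemma lessThan_lesspoll_csucc: "{..<(a::'u)} \<prec> {..<csucc a}"
proof -
  obtain b :: 'u where "Pow {..<a} \<lesssim> {..<b}" using Pow_lepoll_lessThan by blast
  then have "{..<a} \<prec> {..<b}" using lesspoll_Pow_self lesspoll_trans2 by blast
  then show ?thesis unfolding csucc_def by (rule LeastI)
qed

lemma less_csucc: "(a::'u) < csucc a"
  using lessThan_lesspoll_csucc[of a] lepoll_lessThan_mono[of "csucc a" a]
  by (meson leI lesspoll_def lesspoll_trans2 lesspoll_not_refl)

lemma osuc_less_csucc:
  assumes "infinite {..<(a::'u)}" "b < csucc a"
  shows "osuc b < csucc a"
proof (rule ccontr)
  assume "\<not> osuc b < csucc a"
  then have "csucc a = osuc b" using osuc_le[OF assms(2)] by auto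
  then have "{..<csucc a} = insert b {..<b}" using lessThan_osuc by auto
  also have "\<dots> \<lesssim> {..<a}"
    using Un_lepoll_infinite[of "{..<a}" "{b}" "{..<b}"] assms lessThan_lepoll_if_less_csucc[of b a]
      finite_lepoll_infinite[of "{..<a}" "{b}"] by simp
  finally show False using lessThan_lesspoll_csucc[of a] by (meson lesspoll_trans2 lesspoll_not_refl)
qed

text \<open>
  Successor cardinals are regular: if every fibre were bounded, then \<open>g\<^sup>+\<close> would be a union of at
  most \<open>g\<close> initial segments, each of cardinality at most \<open>g\<close>.
\<close>

lemma unbounded_fibre:
  assumes inf: "infinite {..<(g::'u)}" and small: "h ` {..<csucc g} \<lesssim> {..<g}"
  shows "\<exists>v. \<forall>\<zeta><csucc g. \<exists>\<zeta>'. \<zeta> \<le> \<zeta>' \<and> \<zeta>' < csucc g \<and> h \<zeta>' = v"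
proof (rule ccontr)
  assume "\<not> ?thesis"
  then obtain b where b: "\<And>v. b v < csucc g" "\<And>v \<zeta>'. b v \<le> \<zeta>' \<Longrightarrow> \<zeta>' < csucc g \<Longrightarrow> h \<zeta>' \<noteq> v"
    by metis
  have "{..<csucc g} \<lesssim> (\<Union>v\<in>h ` {..<csucc g}. {..<b v})"
    using b(2) by (intro subset_imp_lepoll) (force simp: not_le[symmetric])
  also have "\<dots> \<lesssim> {..<g}"
    using inf small b(1) by (intro UN_lepoll_infinite) (auto intro: lessThan_lepoll_if_less_csucc)
  finally show False
    using lessThan_lesspoll_csucc[of g]
    by (meson lesspoll_trans2 lesspoll_not_refl)
qed

lemma daleth_le_limit:
  assumes "\<delta> \<noteq> ozero" "\<forall>\<beta><\<delta>. \<delta> \<noteq> osuc \<beta>" "\<beta> < (\<delta>::'u)"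
  shows "daleth F \<beta> \<le> daleth F \<delta>"
  unfolding daleth_limit[OF assms(1,2)] using assms(3)
  by (intro le_osup) (auto simp: small_def intro: image_lepoll)

lemma is_card_daleth:
  assumes "\<And>\<mu> n. is_card \<mu> \<Longrightarrow> is_card (F \<mu> n)"
  shows "is_card (daleth F (\<alpha>::'u))"
proof (induction \<alpha> rule: less_induct)
  case (less \<alpha>)
  consider "\<alpha> = ozero" | \<beta> where "\<beta> < \<alpha>" "\<alpha> = osuc \<beta>"
    | "\<alpha> \<noteq> ozero" "\<forall>\<beta><\<alpha>. \<alpha> \<noteq> osuc \<beta>" by blast
  then show ?case
  proof cases
    case 1
    then show ?thesis by (simp add: daleth_ozero is_card_aleph0)
  next
    case 2
    then show ?thesis using less assms
      by (auto simp: daleth_osuc[OF univ] intro!: is_card_osup small_countable)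
  next
    case 3
    have "small (daleth F ` {..<\<alpha>})" unfolding small_def using image_lepoll by blast
    then show ?thesis unfolding daleth_limit[OF 3] using less by (auto intro: is_card_osup)
  qed
qed

lemma le_daleth_osuc: "F (daleth F (\<alpha>::'u)) n \<le> daleth F (osuc \<alpha>)"
  unfolding daleth_osuc[OF univ] by (intro le_osup small_countable) auto

context
  fixes F :: "'u \<Rightarrow> nat \<Rightarrow> 'u"
  assumes growth: "\<And>\<alpha>. daleth F \<alpha> < daleth F (osuc \<alpha>)"
begin

lemma daleth_mono: "\<alpha> \<le> \<beta> \<Longrightarrow> daleth F \<alpha> \<le> daleth F \<beta>"
proof (induction \<beta> rule: less_induct)
  case (less \<beta>)
  show ?case
  proof (cases "\<alpha> = \<beta>")
    case False
    with less.prems have "\<alpha> < \<beta>" by simp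
    then have "\<beta> \<noteq> ozero" using ozero_le[of \<alpha>] by (metis not_le)
    show ?thesis
    proof (cases "\<exists>\<gamma><\<beta>. \<beta> = osuc \<gamma>")
      case True
      then obtain \<gamma> where \<gamma>: "\<gamma> < \<beta>" "\<beta> = osuc \<gamma>" by blast
      have "\<alpha> \<le> \<gamma>" using \<open>\<alpha> < \<beta>\<close> osuc_le[of \<gamma> \<alpha>] \<gamma> by (meson not_le)
      then show ?thesis using less.IH[OF \<gamma>(1)] growth[of \<gamma>] \<gamma>(2) by simp
    qed (use \<open>\<alpha> < \<beta>\<close> \<open>\<beta> \<noteq> ozero\<close> in \<open>auto intro: daleth_le_limit\<close>)
  qed simp
qed

lemma daleth_strict_mono: "\<alpha> < \<beta> \<Longrightarrow> daleth F \<alpha> < daleth F \<beta>"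
  using growth[of \<alpha>] daleth_mono[OF osuc_le] by (meson less_le_trans)

lemma le_daleth: "\<alpha> \<le> daleth F \<alpha>"
  by (induction \<alpha> rule: less_induct) (meson daleth_strict_mono not_le)

text \<open>
  Since the infinite successor \<open>g\<^sup>+\<close> is a limit ordinal, \<open>\<daleth>\<^sup>F\<close> at \<open>g\<^sup>+\<close> is the supremum of its
  earlier values, which are therefore cofinal in it.
\<close>

lemma less_daleth_csucc:
  assumes "infinite {..<g}" "\<beta> < daleth F (csucc g)"
  shows "\<exists>\<zeta><csucc g. \<beta> < daleth F \<zeta>"
proof -
  have "csucc g \<noteq> ozero" using less_csucc[of g] ozero_le[of g] by (metis not_le)
  moreover have "\<forall>\<beta><csucc g. csucc g \<noteq> osuc \<beta>" using osuc_less_csucc[OF assms(1)] by fastforce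
  ultimately show ?thesis using assms(2) less_osup by (fastforce simp: daleth_limit)
qed

end

end

section \<open>Types in abstract classes\<close>

text \<open>
  The part of being an abstract class on which the elementary facts about types rest.  It is isolated
  because it is immediate for the class of all \<open>\<tau>\<close>-structures, so that these facts serve
  \<open>K\<close>-types and quantifier-free types alike.
\<close>

definition refines_substructure :: "'u::wellorder aclass \<Rightarrow> bool" where
  "refines_substructure K \<longleftrightarrow>
     (\<forall>M N. le K M N \<longrightarrow> M \<in> mem K \<and> N \<in> mem K \<and> substructure (lng K) M N) \<and>
     (\<forall>M\<in>mem K. le K M M)"

lemma refines_substructure_abstract_class: "abstract_class K \<Longrightarrow> refines_substructure K"
  unfolding abstract_class_def refines_substructure_def by blast

lemma induced_univ_eq: "is_struct \<tau> M \<Longrightarrow> induced M (univ M) = M"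
  unfolding induced_def is_struct_def by (intro struct.equality) (auto simp: fun_eq_iff)

lemma refines_substructure_all_structs: "refines_substructure (all_structs \<tau>)"
  unfolding refines_substructure_def all_structs_def
  by (auto simp: substructure_def induced_univ_eq)

lemma substructure_rel_iff:
  assumes "substructure \<tau> M N" "set xs \<subseteq> univ M"
  shows "rel M r xs \<longleftrightarrow> rel N r xs"
proof -
  have "rel M = rel (induced N (univ M))"
    using assms(1) unfolding substructure_def by (metis (no_types))
  then show ?thesis using assms(2) by (simp add: induced_def)
qed

lemma substructure_fn_eq:
  assumes "substructure \<tau> M N" "set xs \<subseteq> univ M"
  shows "fn M g xs = fn N g xs"
proof -
  have "fn M = fn (induced N (univ M))"
    using assms(1) unfolding substructure_def by (metis (no_types))
  then show ?thesis using assms(2) by (simp add: induced_def)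
qed

lemma tuple_in_le: "refines_substructure K \<Longrightarrow> le K M N \<Longrightarrow> tuple_in K M a \<Longrightarrow> tuple_in K N a"
  unfolding refines_substructure_def tuple_in_def substructure_def by blast

lemma K_embedding_le:
  assumes "refines_substructure K" "le K M N"
  shows "K_embedding K id M N"
proof -
  have sub: "substructure (lng K) M N" and mem: "M \<in> mem K" "N \<in> mem K"
    using assms unfolding refines_substructure_def by blast+
  then have "embedding (lng K) id M N"
    by (auto simp: embedding_def substructure_rel_iff substructure_fn_eq substructure_def)
  moreover have "induced N (id ` univ M) = M"
    using sub unfolding substructure_def by auto
  ultimately show ?thesis using assms(2) mem unfolding K_embedding_def by simp
qed

lemma type_link_iff:
  "type_link K p q \<longleftrightarrow> tuple_in K (fst p) (snd p) \<and> tuple_in K (fst q) (snd q) \<and>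
     (\<exists>J f. le K (fst p) J \<and> K_embedding K f (fst q) J \<and> snd p = map f (snd q))"
  unfolding type_link_def by (cases p, cases q) simp

text \<open>
  A type link is a directed step, but passing to an extension is a link in both directions: amalgamate
  inside the larger structure, with the inclusion on one side and the identity on the other.
  Equality of the types in the two structures follows from transitivity alone.
\<close>

lemma type_link_le:
  assumes "refines_substructure K" "le K M N" "tuple_in K M a"
  shows "type_link K (M, a) (N, a)" "type_link K (N, a) (M, a)"
proof -
  have *: "tuple_in K N a" "le K N N"
    using assms tuple_in_le unfolding refines_substructure_def by blast+
  show "type_link K (M, a) (N, a)"
    unfolding type_link_def using assms * K_embedding_le[OF assms(1) *(2)]
    by (auto intro!: exI[of _ N] exI[of _ id])
  show "type_link K (N, a) (M, a)"
    unfolding type_link_def using assms * K_embedding_le[OF assms(1,2)]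
    by (auto intro!: exI[of _ N] exI[of _ id])
qed

lemma type_link_refl:
  "refines_substructure K \<Longrightarrow> tuple_in K M a \<Longrightarrow> type_link K (M, a) (M, a)"
  using type_link_le[of K M M a] unfolding refines_substructure_def tuple_in_def by blast

lemma tp_eqI:
  "(type_link K)\<^sup>+\<^sup>+ (M, a) (N, b) \<Longrightarrow> (type_link K)\<^sup>+\<^sup>+ (N, b) (M, a) \<Longrightarrow> tp K a M = tp K b N"
  unfolding tp_def by (auto intro: tranclp_trans)

lemma tp_eqD:
  assumes "refines_substructure K" "tuple_in K N b" "tp K a M = tp K b N"
  shows "(type_link K)\<^sup>+\<^sup>+ (M, a) (N, b)"
  using assms type_link_refl unfolding tp_def by blast

lemma tp_le:
  assumes "refines_substructure K" "le K M N" "tuple_in K M a"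
  shows "tp K a M = tp K a N"
  by (intro tp_eqI tranclp.r_into_trancl type_link_le[OF assms])

lemma type_links_nths:
  assumes "(type_link K)\<^sup>+\<^sup>+ (M, a) (N, b)"
  shows "(type_link K)\<^sup>+\<^sup>+ (M, nths a s) (N, nths b s)"
proof -
  have link: "type_link K p q \<Longrightarrow> type_link K (fst p, nths (snd p) s) (fst q, nths (snd q) s)" for p q
    unfolding type_link_iff tuple_in_def
    by (metis (no_types, lifting) fst_conv snd_conv nths_map order_trans set_nths_subset)
  have "(type_link K)\<^sup>+\<^sup>+ p q \<Longrightarrow>
      (type_link K)\<^sup>+\<^sup>+ (fst p, nths (snd p) s) (fst q, nths (snd q) s)" for p q
    by (induction rule: tranclp_induct) (auto intro: link tranclp.trancl_into_trancl)
  from this[OF assms] show ?thesis by simp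
qed

lemma subtype_tp:
  assumes K: "refines_substructure K" and a: "tuple_in K M a"
  shows "subtype K (tp K a M) s = tp K (nths a s) M"
  unfolding subtype_def
proof (rule the_equality)
  show "\<exists>I b. realizes K I b (tp K a M) \<and> tp K (nths a s) M = tp K (nths b s) I"
    using a unfolding realizes_def by blast
next
  fix q assume "\<exists>I b. realizes K I b (tp K a M) \<and> q = tp K (nths b s) I"
  then obtain I b where b: "tuple_in K I b" "tp K b I = tp K a M" "q = tp K (nths b s) I"
    unfolding realizes_def by blast
  then have "(type_link K)\<^sup>+\<^sup>+ (I, b) (M, a)" "(type_link K)\<^sup>+\<^sup>+ (M, a) (I, b)"
    using K a tp_eqD[of K] by auto
  then show "q = tp K (nths a s) M"
    unfolding b(3) by (intro tp_eqI type_links_nths)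
qed

lemma type_links_length:
  "(type_link K)\<^sup>+\<^sup>+ (M, a) (N, b) \<Longrightarrow> length a = length b"
proof -
  have "(type_link K)\<^sup>+\<^sup>+ p q \<Longrightarrow> length (snd p) = length (snd q)" for p q
    by (induction rule: tranclp_induct) (auto simp: type_link_def)
  then show "(type_link K)\<^sup>+\<^sup>+ (M, a) (N, b) \<Longrightarrow> length a = length b" by fastforce
qed

context
  fixes K :: "'u::wellorder aclass" and lt
  assumes ord: "ordered_class K lt"
begin

lemma ordered_class_refines: "refines_substructure K"
  using ord refines_substructure_abstract_class unfolding ordered_class_def by blast

lemma increasing_le_iff:
  assumes "le K M N" "set a \<subseteq> univ M"
  shows "increasing lt M a \<longleftrightarrow> increasing lt N a"
proof -
  have sub: "substructure (lng K) M N"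
    using assms ordered_class_refines unfolding refines_substructure_def by blast
  then have "rel M lt [x, y] \<longleftrightarrow> rel N lt [x, y]" if "x \<in> set a" "y \<in> set a" for x y
    using that assms(2) substructure_rel_iff[OF sub, of "[x, y]" lt] by auto
  then show ?thesis
    using assms(2) sub unfolding increasing_def substructure_def
    by (auto simp: sorted_wrt_iff_nth_less)
qed

lemma increasing_map_iff:
  assumes "K_embedding K f M N" "set a \<subseteq> univ M"
  shows "increasing lt M a \<longleftrightarrow> increasing lt N (map f a)"
proof -
  have emb: "embedding (lng K) f M N" using assms unfolding K_embedding_def by blast
  have lt: "lt \<in> rsyms (lng K)" "snd lt = 2" using ord unfolding ordered_class_def by blast+
  have "\<forall>xs. length xs = snd lt \<and> set xs \<subseteq> univ M \<longrightarrow> rel M lt xs = rel N lt (map f xs)"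
    using emb lt(1) unfolding embedding_def by blast
  from this[THEN spec, of "[x, y]" for x y]
  have "rel M lt [x, y] \<longleftrightarrow> rel N lt [f x, f y]" if "x \<in> set a" "y \<in> set a" for x y
    using that assms(2) lt(2) by auto
  moreover have "f ` set a \<subseteq> univ N" using emb assms(2) unfolding embedding_def by blast
  ultimately show ?thesis
    using assms(2) unfolding increasing_def by (auto simp: sorted_wrt_map sorted_wrt_iff_nth_less)
qed

text \<open>
  The order symbol is atomic, so every link preserves it.  Consequently any realization of a type of
  increasing tuples is itself increasing.
\<close>

lemma type_links_increasing:
  assumes "(type_link K)\<^sup>+\<^sup>+ (M, a) (N, b)"
  shows "increasing lt M a \<longleftrightarrow> increasing lt N b"
proof -
  have link: "increasing lt (fst p) (snd p) \<longleftrightarrow> increasing lt (fst q) (snd q)"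
    if pq: "type_link K p q" for p q
  proof -
    obtain J f where J: "le K (fst p) J" "K_embedding K f (fst q) J" "snd p = map f (snd q)"
      and sub: "set (snd p) \<subseteq> univ (fst p)" "set (snd q) \<subseteq> univ (fst q)"
      using pq unfolding type_link_iff tuple_in_def by blast
    show ?thesis
      using increasing_le_iff[OF J(1) sub(1)] increasing_map_iff[OF J(2) sub(2)] J(3) by simp
  qed
  have "(type_link K)\<^sup>+\<^sup>+ p q \<Longrightarrow>
      increasing lt (fst p) (snd p) \<longleftrightarrow> increasing lt (fst q) (snd q)" for p q
    by (induction rule: tranclp_induct) (auto simp: link)
  from this[OF assms] show ?thesis by simp
qed

lemma realizes_inc_type:
  assumes "p \<in> inc_types K lt n" "realizes K M a p"
  shows "increasing lt M a" "length a = n"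
proof -
  obtain N b where b: "p = tp K b N" "N \<in> mem K" "increasing lt N b" "length b = n"
    using assms(1) unfolding inc_types_def by blast
  then have "(type_link K)\<^sup>+\<^sup>+ (N, b) (M, a)"
    using assms(2) tp_eqD[OF ordered_class_refines] unfolding realizes_def by metis
  then show "increasing lt M a" "length a = n"
    using b type_links_increasing type_links_length by metis+
qed

lemma tp_in_inc_types:
  "M \<in> mem K \<Longrightarrow> increasing lt M a \<Longrightarrow> tp K a M \<in> inc_types K lt (length a)"
  unfolding inc_types_def by blast

lemma inc_types_subset: "inc_types K lt n \<subseteq> types K n"
  unfolding inc_types_def types_def tuple_in_def increasing_def by blast

lemma inc_types_unique:
  assumes "p \<in> inc_types K lt m" "p \<in> inc_types K lt n"
  shows "m = n"
proof -
  obtain M a where "realizes K M a p"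
    using assms(1) unfolding inc_types_def realizes_def tuple_in_def increasing_def by blast
  then show ?thesis using assms realizes_inc_type(2) by metis
qed

lemma increasing_nths: "increasing lt M a \<Longrightarrow> increasing lt M (nths a s)"
  unfolding increasing_def
proof (induction a arbitrary: s)
  case (Cons x a)
  then show ?case by (auto simp: nths_Cons dest: in_set_nthsD)
qed simp

text \<open>
  A finite set has only one increasing enumeration, which is why a colouring of increasing tuples
  is the same thing as a colouring of finite sets.
\<close>

lemma increasing_unique:
  assumes "M \<in> mem K" "increasing lt M a" "increasing lt M b" "set a = set b"
  shows "a = b"
  using assms(2-4)
proof (induction a arbitrary: b)
  case (Cons x a)
  then obtain y b' where b: "b = y # b'" by (cases b) auto
  have irrefl: "\<not> rel M lt [z, z]" if "z \<in> univ M" for z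
    using ord that assms(1) unfolding ordered_class_def by blast
  have trans: "rel M lt [u, w]" if "rel M lt [u, v]" "rel M lt [v, w]"
    "u \<in> univ M" "v \<in> univ M" "w \<in> univ M" for u v w
    using ord that assms(1) unfolding ordered_class_def by blast
  have xy: "x \<in> univ M" "y \<in> univ M" using Cons.prems b by (auto simp: increasing_def)
  have "x = y"
  proof (rule ccontr)
    assume "x \<noteq> y"
    then have "x \<in> set b'" "y \<in> set a" using Cons.prems(3) b by auto
    then have "rel M lt [y, x]" "rel M lt [x, y]"
      using Cons.prems b by (auto simp: increasing_def)
    then show False using irrefl trans xy by blast
  qed
  have "x \<notin> set a" "y \<notin> set b'" using Cons.prems b irrefl xy by (auto simp: increasing_def)
  then have "set a = set b'" using Cons.prems(3) b \<open>x = y\<close> by auto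
  then show ?case using Cons b \<open>x = y\<close> by (auto simp: increasing_def)
qed (auto)

end

text \<open>
  A structure that realizes all types bounds their number; this is what makes the class of types
  a small set.
\<close>

lemma types_lepoll_lists:
  assumes "\<And>p. p \<in> types K n \<Longrightarrow> \<exists>a. realizes K M a p"
  shows "types K n \<lesssim> lists (univ M)"
proof (rule lepoll_relational_full)
  show "\<exists>a. a \<in> lists (univ M) \<and> realizes K M a p" if "p \<in> types K n" for p
    using assms[OF that] unfolding realizes_def tuple_in_def by blast
qed (auto simp: realizes_def)

section \<open>Counting quantifier-free types\<close>

datatype 'u tm = Var nat | App "'u \<times> nat" "'u tm list"

inductive_set terms :: "'u lang \<Rightarrow> nat \<Rightarrow> 'u tm set" for \<tau> n where
  Var: "i < n \<Longrightarrow> Var i \<in> terms \<tau> n"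
| App: "g \<in> fsyms \<tau> \<Longrightarrow> length ts = snd g \<Longrightarrow> ts \<in> lists (terms \<tau> n) \<Longrightarrow> App g ts \<in> terms \<tau> n"

primrec tm_val :: "'u struct \<Rightarrow> 'u list \<Rightarrow> 'u tm \<Rightarrow> 'u" where
  "tm_val M a (Var i) = a ! i"
| "tm_val M a (App g ts) = fn M g (map (tm_val M a) ts)"

text \<open>
  This encodes the set of atomic formulas that hold of the tuple, in its two parts: equations between
  terms, and relation symbols applied to terms.
\<close>

definition qf_diagram ::
    "'u lang \<Rightarrow> nat \<Rightarrow> 'u struct \<Rightarrow> 'u list \<Rightarrow> ('u tm \<times> 'u tm + ('u \<times> nat) \<times> 'u tm list) set" where
  "qf_diagram \<tau> n M a =
     {(s, t). s \<in> terms \<tau> n \<and> t \<in> terms \<tau> n \<and> tm_val M a s = tm_val M a t} <+>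
     {(r, ts). r \<in> rsyms \<tau> \<and> ts \<in> lists (terms \<tau> n) \<and> rel M r (map (tm_val M a) ts)}"

lemma lang_card_leD:
  assumes "lang_card_le \<tau> \<mu>"
  shows "infinite {..<\<mu>}" "rsyms \<tau> \<lesssim> {..<\<mu>}" "fsyms \<tau> \<lesssim> {..<\<mu>}"
proof -
  have "rsyms \<tau> \<lesssim> rsyms \<tau> <+> fsyms \<tau>" "fsyms \<tau> \<lesssim> rsyms \<tau> <+> fsyms \<tau>"
    unfolding lepoll_def by (rule exI[of _ Inl], auto) (rule exI[of _ Inr], auto)
  then show "infinite {..<\<mu>}" "rsyms \<tau> \<lesssim> {..<\<mu>}" "fsyms \<tau> \<lesssim> {..<\<mu>}"
    using assms unfolding lang_card_le_def by (auto intro: lepoll_trans)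
qed

text \<open>
  Terms of size at most \<open>k\<close> are variables or symbols applied to lists of terms of size less than \<open>k\<close>,
  so by induction on \<open>k\<close> each size contributes at most \<open>\<mu>\<close> terms.
\<close>

lemma terms_lepoll:
  assumes "lang_card_le \<tau> \<mu>"
  shows "terms \<tau> n \<lesssim> {..<\<mu>}"
proof -
  note \<mu> = lang_card_leD[OF assms]
  have "{t \<in> terms \<tau> n. size t < k} \<lesssim> {..<\<mu>}" (is "?T k \<lesssim> _") for k
  proof (induction k)
    case (Suc k)
    have "?T (Suc k) \<subseteq> Var ` {..<n} \<union> (\<lambda>(g, ts). App g ts) ` (fsyms \<tau> \<times> lists (?T k))"
    proof
      fix t assume "t \<in> ?T (Suc k)"
      then have "t \<in> terms \<tau> n" "size t \<le> k" by auto
      then show "t \<in> Var ` {..<n} \<union> (\<lambda>(g, ts). App g ts) ` (fsyms \<tau> \<times> lists (?T k))"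
      proof cases
        case (App g ts)
        have "size u < k" if "u \<in> set ts" for u
          using that \<open>size t \<le> k\<close> App(1) size_list_estimation'[OF that, of "size u" size] by auto
        then have "(g, ts) \<in> fsyms \<tau> \<times> lists (?T k)" using App by auto
        then show ?thesis using App(1) by blast
      qed auto
    qed
    moreover have "Var ` {..<n} \<lesssim> {..<\<mu>}" using \<mu>(1) by (auto intro: finite_lepoll_infinite)
    moreover have "fsyms \<tau> \<times> lists (?T k) \<lesssim> {..<\<mu>}"
      using \<mu> Suc by (intro Times_lepoll_infinite lists_lepoll_infinite)
    then have "(\<lambda>(g, ts). App g ts) ` (fsyms \<tau> \<times> lists (?T k)) \<lesssim> {..<\<mu>}"
      using image_lepoll lepoll_trans by blast
    ultimately show ?case
      by (rule lepoll_trans[OF subset_imp_lepoll Un_lepoll_infinite[OF \<mu>(1)]])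
  qed simp
  then have "(\<Union>k::nat. ?T k) \<lesssim> {..<\<mu>}"
    using \<mu>(1) by (intro UN_lepoll_infinite) (auto simp: infinite_le_lepoll[symmetric])
  moreover have "(\<Union>k::nat. ?T k) = terms \<tau> n" by auto
  ultimately show ?thesis by simp
qed

definition generated :: "'u lang \<Rightarrow> 'u struct \<Rightarrow> 'u list \<Rightarrow> 'u struct" where
  "generated \<tau> M a = induced M (tm_val M a ` terms \<tau> (length a))"

lemma univ_generated: "univ (generated \<tau> M a) = tm_val M a ` terms \<tau> (length a)"
  unfolding generated_def induced_def by simp

lemma tm_val_in_univ:
  assumes "is_struct \<tau> M" "set a \<subseteq> univ M" "t \<in> terms \<tau> (length a)"
  shows "tm_val M a t \<in> univ M"
  using assms(3)
proof induction
  case (App g ts)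
  then have "set (map (tm_val M a) ts) \<subseteq> univ M" by auto
  moreover have "\<forall>g xs. g \<in> fsyms \<tau> \<and> length xs = snd g \<and> set xs \<subseteq> univ M \<longrightarrow> fn M g xs \<in> univ M"
    using assms(1) unfolding is_struct_def by presburger
  ultimately show ?case using App.hyps(1,2) by (metis length_map tm_val.simps(2))
qed (use assms(2) in auto)

lemma lists_tm_val_image:
  assumes "set xs \<subseteq> tm_val M a ` T"
  obtains ts where "ts \<in> lists T" "xs = map (tm_val M a) ts"
proof -
  have "xs \<in> map (tm_val M a) ` lists T"
    using assms by (simp add: lists_image[symmetric] in_lists_conv_set subset_code(1))
  then show thesis using that by blast
qed

lemma generated_substructure:
  assumes M: "is_struct \<tau> M" and a: "set a \<subseteq> univ M"
  shows "substructure \<tau> (generated \<tau> M a) M"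
proof -
  let ?G = "tm_val M a ` terms \<tau> (length a)"
  have sub: "?G \<subseteq> univ M" using tm_val_in_univ[OF M a] by blast
  then have "small ?G"
    using M unfolding is_struct_def small_def by (meson lepoll_trans subset_imp_lepoll)
  moreover have "fn M g xs \<in> ?G" if "g \<in> fsyms \<tau>" "length xs = snd g" and xs: "set xs \<subseteq> ?G" for g xs
  proof -
    obtain ts where ts: "ts \<in> lists (terms \<tau> (length a))" "xs = map (tm_val M a) ts"
      using lists_tm_val_image[OF xs] .
    then have "App g ts \<in> terms \<tau> (length a)" using that by (intro terms.App) auto
    then show ?thesis using ts(2) by (metis imageI tm_val.simps(2))
  qed
  ultimately have "is_struct \<tau> (generated \<tau> M a)"
    using M sub unfolding is_struct_def generated_def induced_def by auto
  then show ?thesis using M sub unfolding substructure_def univ_generated by (simp add: generated_def)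
qed

lemma set_subset_generated: "set a \<subseteq> univ (generated \<tau> M a)"
proof
  fix x assume "x \<in> set a"
  then obtain i where "i < length a" "x = a ! i" by (auto simp: in_set_conv_nth)
  then have "Var i \<in> terms \<tau> (length a)" "x = tm_val M a (Var i)" by (auto intro: terms.Var)
  then show "x \<in> univ (generated \<tau> M a)" unfolding univ_generated by blast
qed

lemma qf_diagram_eqD:
  assumes "qf_diagram \<tau> n M a = qf_diagram \<tau> n N b"
  shows "s \<in> terms \<tau> n \<Longrightarrow> t \<in> terms \<tau> n \<Longrightarrow>
      tm_val M a s = tm_val M a t \<longleftrightarrow> tm_val N b s = tm_val N b t"
    and "r \<in> rsyms \<tau> \<Longrightarrow> ts \<in> lists (terms \<tau> n) \<Longrightarrow>
      rel M r (map (tm_val M a) ts) \<longleftrightarrow> rel N r (map (tm_val N b) ts)"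
proof -
  show "tm_val M a s = tm_val M a t \<longleftrightarrow> tm_val N b s = tm_val N b t"
    if "s \<in> terms \<tau> n" "t \<in> terms \<tau> n"
  proof -
    have "Inl (s, t) \<in> qf_diagram \<tau> n M a \<longleftrightarrow> Inl (s, t) \<in> qf_diagram \<tau> n N b" using assms by simp
    then show ?thesis using that by (auto simp: qf_diagram_def)
  qed
  show "rel M r (map (tm_val M a) ts) \<longleftrightarrow> rel N r (map (tm_val N b) ts)"
    if "r \<in> rsyms \<tau>" "ts \<in> lists (terms \<tau> n)"
  proof -
    have "Inr (r, ts) \<in> qf_diagram \<tau> n M a \<longleftrightarrow> Inr (r, ts) \<in> qf_diagram \<tau> n N b" using assms by simp
    then show ?thesis using that by (auto simp: qf_diagram_def)
  qed
qed

text \<open>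
  Sending the value of each term at \<open>a\<close> to its value at \<open>b\<close> is well defined and injective because
  the same equations hold; it is then an isomorphism of the generated substructures.
\<close>

lemma qf_diagram_embedding:
  assumes M: "is_struct \<tau> M" "set a \<subseteq> univ M" and N: "is_struct \<tau> N" "set b \<subseteq> univ N"
    and len: "length a = n" "length b = n" and eq: "qf_diagram \<tau> n M a = qf_diagram \<tau> n N b"
  obtains f where "embedding \<tau> f (generated \<tau> M a) (generated \<tau> N b)"
    "f ` univ (generated \<tau> M a) = univ (generated \<tau> N b)" "map f a = b"
proof -
  note eqD = qf_diagram_eqD[OF eq]
  let ?T = "terms \<tau> n"
  have uM: "univ (generated \<tau> M a) = tm_val M a ` ?T" and uN: "univ (generated \<tau> N b) = tm_val N b ` ?T"
    using len by (simp_all add: univ_generated)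
  note subM = generated_substructure[OF M] and subN = generated_substructure[OF N]
  define f where "f x = tm_val N b (SOME t. t \<in> ?T \<and> tm_val M a t = x)" for x
  have f: "f (tm_val M a t) = tm_val N b t" if "t \<in> ?T" for t
  proof -
    have "\<exists>s. s \<in> ?T \<and> tm_val M a s = tm_val M a t" using that by blast
    from someI_ex[OF this] show ?thesis using eqD(1) that unfolding f_def by blast
  qed
  have map_f: "map f (map (tm_val M a) ts) = map (tm_val N b) ts" if "ts \<in> lists ?T" for ts
    using that f by (induction ts) auto
  have sub_univ: "set (map (tm_val M a) ts) \<subseteq> univ (generated \<tau> M a)"
    "set (map (tm_val N b) ts) \<subseteq> univ (generated \<tau> N b)" if "ts \<in> lists ?T" for ts
    using that unfolding uM uN by auto
  have "inj_on f (univ (generated \<tau> M a))"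
    unfolding uM using f eqD(1) by (auto simp: inj_on_def)
  moreover have image: "f ` univ (generated \<tau> M a) = univ (generated \<tau> N b)"
    unfolding uM uN using f by (auto simp: image_image)
  moreover have "rel (generated \<tau> M a) r xs \<longleftrightarrow> rel (generated \<tau> N b) r (map f xs)"
    if r: "r \<in> rsyms \<tau>" and xs: "set xs \<subseteq> univ (generated \<tau> M a)" for r xs
  proof -
    obtain ts where ts: "ts \<in> lists ?T" "xs = map (tm_val M a) ts"
      using lists_tm_val_image xs unfolding uM by metis
    then show ?thesis
      using eqD(2)[OF r ts(1)] map_f[OF ts(1)] sub_univ[OF ts(1)]
        substructure_rel_iff[OF subM] substructure_rel_iff[OF subN] by metis
  qed
  moreover have "f (fn (generated \<tau> M a) g xs) = fn (generated \<tau> N b) g (map f xs)"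
    if g: "g \<in> fsyms \<tau>" "length xs = snd g" and xs: "set xs \<subseteq> univ (generated \<tau> M a)" for g xs
  proof -
    obtain ts where ts: "ts \<in> lists ?T" "xs = map (tm_val M a) ts"
      using lists_tm_val_image xs unfolding uM by metis
    then have "App g ts \<in> ?T" using g by (intro terms.App) auto
    from f[OF this] show ?thesis
      using map_f[OF ts(1)] sub_univ[OF ts(1)] ts(2)
        substructure_fn_eq[OF subM] substructure_fn_eq[OF subN] by (metis tm_val.simps(2))
  qed
  ultimately have "embedding \<tau> f (generated \<tau> M a) (generated \<tau> N b)"
    using subM subN unfolding embedding_def substructure_def by blast
  moreover have "map f a = b"
  proof (rule nth_equalityI)
    fix i assume "i < length (map f a)"
    then show "map f a ! i = b ! i" using f[of "Var i"] len by (simp add: terms.Var)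
  qed (simp add: len)
  ultimately show thesis using image that by blast
qed

text \<open>
  The chain of links runs from \<open>M\<close> down to the substructure generated by \<open>a\<close>, across the isomorphism
  to the one generated by \<open>b\<close>, and up to \<open>N\<close>.  The isomorphism can be used in both directions, so
  there are chains both ways.
\<close>

lemma tp_eq_if_qf_diagram_eq:
  assumes M: "is_struct \<tau> M" "set a \<subseteq> univ M" and N: "is_struct \<tau> N" "set b \<subseteq> univ N"
    and len: "length a = n" "length b = n" and eq: "qf_diagram \<tau> n M a = qf_diagram \<tau> n N b"
  shows "tp (all_structs \<tau>) a M = tp (all_structs \<tau>) b N"
proof -
  let ?K = "all_structs \<tau>"
  note K = refines_substructure_all_structs[of \<tau>]
  have tuple: "tuple_in ?K (generated \<tau> M a) a"
    and gen: "tp ?K a (generated \<tau> M a) = tp ?K a M"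
    if "is_struct \<tau> M" "set a \<subseteq> univ M" for M :: "'a struct" and a
  proof -
    have sub: "substructure \<tau> (generated \<tau> M a) M" using generated_substructure that .
    then show "tuple_in ?K (generated \<tau> M a) a"
      using set_subset_generated[of a \<tau> M] unfolding tuple_in_def all_structs_def substructure_def
      by simp
    then show "tp ?K a (generated \<tau> M a) = tp ?K a M"
      using tp_le[OF K] sub by (simp add: all_structs_def)
  qed
  have link: "type_link ?K (generated \<tau> N b, b) (generated \<tau> M a, a)"
    if M: "is_struct \<tau> M" "set a \<subseteq> univ M" and N: "is_struct \<tau> N" "set b \<subseteq> univ N"
      and len: "length a = n" "length b = n" and eq: "qf_diagram \<tau> n M a = qf_diagram \<tau> n N b"
    for M N :: "'a struct" and a b
  proof -
    obtain f where f: "embedding \<tau> f (generated \<tau> M a) (generated \<tau> N b)"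
      "f ` univ (generated \<tau> M a) = univ (generated \<tau> N b)" "map f a = b"
      using qf_diagram_embedding[OF M N len eq] .
    have struct: "is_struct \<tau> (generated \<tau> M a)" "is_struct \<tau> (generated \<tau> N b)"
      using f(1) unfolding embedding_def by blast+
    then have "le ?K (generated \<tau> N b) (generated \<tau> N b)"
      using K unfolding refines_substructure_def by (simp add: all_structs_def)
    moreover from this have "K_embedding ?K f (generated \<tau> M a) (generated \<tau> N b)"
      using f struct induced_univ_eq[OF struct(2)]
      unfolding K_embedding_def by (simp add: all_structs_def)
    ultimately show ?thesis
      using f(3) tuple[OF M] tuple[OF N] unfolding type_link_iff by auto
  qed
  have "tp ?K a (generated \<tau> M a) = tp ?K b (generated \<tau> N b)"
    using link[OF M N len eq] link[OF N M len(2,1) eq[symmetric]] by (intro tp_eqI) auto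
  then show ?thesis using gen[OF M] gen[OF N] by simp
qed

text \<open>
  By the previous lemma a type is determined by a diagram, and diagrams are subsets of a set of
  cardinality at most \<open>\<mu>\<close>.
\<close>

lemma types_all_structs_lepoll:
  assumes "lang_card_le \<tau> \<mu>"
  shows "types (all_structs \<tau>) n \<lesssim> Pow {..<\<mu>}"
proof -
  let ?E = "terms \<tau> n \<times> terms \<tau> n <+> rsyms \<tau> \<times> lists (terms \<tau> n)"
  let ?R = "\<lambda>x p. \<exists>M a. is_struct \<tau> M \<and> set a \<subseteq> univ M \<and> length a = n \<and>
    x = qf_diagram \<tau> n M a \<and> p = tp (all_structs \<tau>) a M"
  have "types (all_structs \<tau>) n \<lesssim> Pow ?E"
  proof (rule lepoll_relational_full[where R = ?R])
    fix p assume "p \<in> types (all_structs \<tau>) n"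
    then obtain a M where "p = tp (all_structs \<tau>) a M" "is_struct \<tau> M" "set a \<subseteq> univ M" "length a = n"
      unfolding types_def tuple_in_def by (auto simp: all_structs_def)
    moreover have "qf_diagram \<tau> n M a \<in> Pow ?E" unfolding qf_diagram_def by auto
    ultimately show "\<exists>x. x \<in> Pow ?E \<and> ?R x p" by blast
  next
    fix x p q assume "?R x p" "?R x q"
    then show "p = q" using tp_eq_if_qf_diagram_eq by (metis (no_types, lifting))
  qed
  also have "?E \<lesssim> {..<\<mu>}"
    using lang_card_leD[OF assms] terms_lepoll[OF assms]
    by (intro Plus_lepoll_infinite Times_lepoll_infinite lists_lepoll_infinite)
  then have "Pow ?E \<lesssim> Pow {..<\<mu>}" by (rule Pow_lepoll_mono)
  finally show ?thesis .
qed

section \<open>Homogenising families\<close>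

text \<open>
  This is the exponent law for \<open>A\<close>-th powers of \<open>2\<^sup>C\<close>: a function with values in the power set of \<open>C\<close>
  is the same thing as a set of pairs.
\<close>

lemma PiE_lepoll_Pow_Times:
  assumes "B \<lesssim> Pow C"
  shows "(A \<rightarrow>\<^sub>E B) \<lesssim> Pow (C \<times> A)"
proof -
  obtain e where e: "inj_on e B" "e ` B \<subseteq> Pow C" using assms unfolding lepoll_def by blast
  let ?graph = "\<lambda>h. {(c, a). a \<in> A \<and> c \<in> e (h a)}"
  have "inj_on ?graph (A \<rightarrow>\<^sub>E B)"
  proof (rule inj_onI)
    fix h k assume hk: "h \<in> A \<rightarrow>\<^sub>E B" "k \<in> A \<rightarrow>\<^sub>E B" "?graph h = ?graph k"
    show "h = k"
    proof (rule PiE_ext[OF hk(1,2)])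
      fix a assume "a \<in> A"
      then have "e (h a) = e (k a)" using hk(3) by (auto simp: set_eq_iff)
      then show "h a = k a" using e(1) hk \<open>a \<in> A\<close> by (meson PiE_mem inj_onD)
    qed
  qed
  moreover have "?graph ` (A \<rightarrow>\<^sub>E B) \<subseteq> Pow (C \<times> A)"
    using e(2) by (auto dest!: PiE_mem)
  ultimately show ?thesis unfolding lepoll_def by blast
qed

lemma bigness_mono:
  assumes "bigness K big" "abstract_class K" "is_card \<mu>" "is_card \<nu>" "\<mu> \<le> \<nu>" "M \<in> big \<nu>"
  shows "M \<in> big \<mu>"
  using assms unfolding bigness_def abstract_class_def by (meson subsetD)

lemma small_univ: "is_struct \<tau> M \<Longrightarrow> small (univ M)"
  by (simp only: is_struct_def)

text \<open>
  The partition relation, transferred from colourings of finite sets by ordinals to colourings of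
  increasing tuples with values in an arbitrary set of colours.
\<close>

lemma homogenise:
  assumes ord: "ordered_class K lt" and arrow: "arrows K lt big \<theta> \<mu> n \<kappa>"
    and J: "J \<in> big \<theta>" "J \<in> mem K" and T: "T \<lesssim> {..<\<kappa>}" "{..<\<kappa>} \<noteq> {}"
    and v: "\<And>a. increasing lt J a \<Longrightarrow> length a = n \<Longrightarrow> v a \<in> T"
  shows "\<exists>J0\<in>big \<mu>. le K J0 J \<and>
    (\<exists>\<Phi>. \<forall>a. increasing lt J0 a \<and> length a = n \<longrightarrow> v a = \<Phi> (tp K a J))"
proof -
  obtain e where e: "inj_on e T" "e ` T \<subseteq> {..<\<kappa>}" using T unfolding lepoll_def by blast
  obtain z where z: "z < \<kappa>" using T by blast
  define enum where "enum X a \<longleftrightarrow> increasing lt J a \<and> length a = n \<and> set a = X" for X a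
  define c where "c X = (if \<exists>a. enum X a then e (v (SOME a. enum X a)) else z)" for X
  have c: "c (set a) = e (v a)" if a: "increasing lt J a" "length a = n" for a
  proof -
    have enum: "enum (set a) a" using a unfolding enum_def by simp
    then have "enum (set a) (SOME b. enum (set a) b)" by (rule someI)
    then have "(SOME b. enum (set a) b) = a"
      using a increasing_unique[OF ord J(2)] unfolding enum_def by blast
    then show ?thesis using enum unfolding c_def by auto
  qed
  have "c X < \<kappa>" for X
  proof (cases "\<exists>a. enum X a")
    case True
    then obtain a where "enum X a" by blast
    then show ?thesis using c[of a] v[of a] e(2) unfolding enum_def by auto
  qed (simp add: c_def z)
  then obtain J0 where J0: "J0 \<in> big \<mu>" "le K J0 J" "type_homogeneous K lt n \<kappa> J c J0"
    using arrow J(1) unfolding arrows_def by blast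
  then obtain c' where c': "\<And>a. increasing lt J0 a \<Longrightarrow> length a = n \<Longrightarrow> c (set a) = c' (tp K a J)"
    unfolding type_homogeneous_def by blast
  have "v a = inv_into T e (c' (tp K a J))" if a: "increasing lt J0 a" "length a = n" for a
  proof -
    have "increasing lt J a"
      using a(1) increasing_le_iff[OF ord J0(2)] unfolding increasing_def by blast
    then have "c' (tp K a J) = e (v a)" "v a \<in> T" using c c'[OF a] v a(2) by auto
    then show ?thesis using e(1) by simp
  qed
  then show ?thesis
    using J0(1,2) by (intro bexI[of _ J0] conjI exI[of _ "\<lambda>p. inv_into T e (c' p)"]) auto
qed

context
  fixes K :: "'u::wellorder aclass" and lt and big :: "'u \<Rightarrow> 'u struct set"
  assumes univ: "set_universe TYPE('u)" and ord: "ordered_class K lt" and big: "bigness K big"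
begin

lemma abstract: "abstract_class K"
  using ord unfolding ordered_class_def by blast

lemma K_leD:
  assumes "le K M N"
  shows "M \<in> mem K" "N \<in> mem K" "univ M \<subseteq> univ N"
proof -
  have "M \<in> mem K \<and> N \<in> mem K \<and> substructure (lng K) M N"
    using assms ordered_class_refines[OF ord] unfolding refines_substructure_def by blast
  then show "M \<in> mem K" "N \<in> mem K" "univ M \<subseteq> univ N" unfolding substructure_def by simp_all
qed

lemma K_le_trans: "le K M N \<Longrightarrow> le K N P \<Longrightarrow> le K M P"
  using abstract unfolding abstract_class_def by meson

lemma big_card_realizes:
  assumes "is_card \<mu>" "aleph0 \<le> \<mu>" "M \<in> big \<mu>" "p \<in> types K n"
  shows "\<exists>a. realizes K M a p"
proof -
  have "M \<in> big aleph0"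
    using bigness_mono[OF big abstract is_card_aleph0[OF univ] assms(1-3)] .
  then show ?thesis using big assms(4) unfolding bigness_def by blast
qed

text \<open>
  The \<open>n\<close>-th term of the supremum that defines \<open>g\<close> is meaningful because \<open>\<aleph>\<^sub>0\<close>-big structures realize
  all types, so that there are only set-many of them.
\<close>

lemma Pow_Times_types_lepoll_g_fun: "Pow ({..<\<mu>} \<times> types K n) \<lesssim> {..<g_fun K \<mu>}"
proof -
  obtain M where M: "M \<in> big aleph0" "M \<in> mem K"
    using big is_card_aleph0[OF univ] unfolding bigness_def by blast
  then obtain a :: 'u where "univ M \<lesssim> {..<a}"
    using M(2) abstract small_univ unfolding abstract_class_def small_def by meson
  then obtain b :: 'u where b: "infinite {..<b}" "univ M \<lesssim> {..<b}" "\<mu> \<le> b"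
    using lepoll_infinite_lessThan[OF univ] by blast
  have "types K n \<lesssim> lists (univ M)"
    using big_card_realizes[OF is_card_aleph0[OF univ] order_refl M(1)] by (rule types_lepoll_lists)
  also have "\<dots> \<lesssim> {..<b}" using b by (intro lists_lepoll_infinite)
  finally have "{..<\<mu>} \<times> types K n \<lesssim> {..<b}"
    using b by (intro Times_lepoll_infinite lepoll_lessThan_mono)
  then obtain d :: 'u where "Pow ({..<\<mu>} \<times> types K n) \<lesssim> {..<d}"
    using Pow_lepoll_lessThan[OF univ] by blast
  from lepoll_crd[OF this] show ?thesis
    unfolding g_fun_def
    by (rule lepoll_trans) (intro lepoll_lessThan_mono le_osup[OF univ] small_countable[OF univ] rangeI)
qed

lemma Pow_lepoll_g_fun: "Pow {..<\<mu>} \<lesssim> {..<g_fun K \<mu>}"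
proof -
  obtain M where "M \<in> mem K"
    using big is_card_aleph0[OF univ] unfolding bigness_def by blast
  then have "tp K [] M \<in> types K 0" unfolding types_def tuple_in_def by fastforce
  then have "{..<\<mu>} \<lesssim> {..<\<mu>} \<times> types K 0"
    unfolding lepoll_def
    by (intro exI[of _ "\<lambda>x. (x, tp K [] M)"]) (auto simp: inj_on_def)
  then show ?thesis using Pow_Times_types_lepoll_g_fun Pow_lepoll_mono lepoll_trans by blast
qed

context
  fixes F :: "'u \<Rightarrow> nat \<Rightarrow> 'u" and \<mu> :: 'u and \<tau> :: "'u lang"
    and M I :: "'u \<Rightarrow> 'u struct" and f :: "'u \<Rightarrow> 'u \<Rightarrow> 'u"
  assumes ER: "combinatorial_ER K lt big F"
    and growth: "\<And>\<alpha>. daleth F \<alpha> < daleth F (osuc \<alpha>)"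
    and \<tau>: "lang_card_le \<tau> \<mu>"
    and M: "\<And>\<alpha>. is_card \<alpha> \<Longrightarrow> \<alpha> < f_fun K F \<mu> \<Longrightarrow> is_struct \<tau> (M \<alpha>)"
    and I: "\<And>\<alpha>. is_card \<alpha> \<Longrightarrow> \<alpha> < f_fun K F \<mu> \<Longrightarrow> I \<alpha> \<in> big \<alpha>"
    and f: "\<And>\<alpha>. is_card \<alpha> \<Longrightarrow> \<alpha> < f_fun K F \<mu> \<Longrightarrow> f \<alpha> ` univ (I \<alpha>) \<subseteq> univ (M \<alpha>)"
begin

abbreviation "height \<equiv> csucc (g_fun K \<mu>)"

text \<open>
  The stages of the construction.  The member \<open>(J, \<alpha>)\<close> at index \<open>\<zeta>\<close> is a big structure \<open>J\<close> together with
  the index \<open>\<alpha>\<close> of the given structure below which it lies; the bound \<open>\<daleth>\<^sup>F\<^sub>\<zeta> \<le> \<alpha>\<close> keeps these indices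
  cofinal in \<open>\<chi>\<close>.
\<close>

definition large_family :: "('u \<Rightarrow> 'u struct \<times> 'u) \<Rightarrow> bool" where
  "large_family S \<longleftrightarrow> (\<forall>\<zeta><height. case S \<zeta> of (J, \<alpha>) \<Rightarrow>
     is_card \<alpha> \<and> daleth F \<zeta> \<le> \<alpha> \<and> \<alpha> < f_fun K F \<mu> \<and> J \<in> big (daleth F \<zeta>) \<and> le K J (I \<alpha>))"

text \<open>
  The structure at an index may come from another index of the previous family, because the
  pigeonhole step discards some members and renumbers the others.
\<close>

definition refines_family :: "('u \<Rightarrow> 'u struct \<times> 'u) \<Rightarrow> ('u \<Rightarrow> 'u struct \<times> 'u) \<Rightarrow> bool" where
  "refines_family S' S \<longleftrightarrow> (\<forall>\<zeta><height. \<exists>\<zeta>'<height.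
     snd (S' \<zeta>) = snd (S \<zeta>') \<and> le K (fst (S' \<zeta>)) (fst (S \<zeta>')))"

definition homogeneous_family ::
    "nat \<Rightarrow> ('u pointed set \<Rightarrow> 'u pointed set) \<Rightarrow> ('u \<Rightarrow> 'u struct \<times> 'u) \<Rightarrow> bool" where
  "homogeneous_family n \<Phi> S \<longleftrightarrow> (\<forall>\<zeta><height. case S \<zeta> of (J, \<alpha>) \<Rightarrow>
     \<forall>a. increasing lt J a \<and> length a = n \<longrightarrow>
       tp (all_structs \<tau>) (map (f \<alpha>) a) (M \<alpha>) = \<Phi> (tp K a (I \<alpha>)))"

lemma infinite_g_fun: "infinite {..<g_fun K \<mu>}"
proof -
  have "{..<\<mu>} \<lesssim> {..<g_fun K \<mu>}" using Pow_lepoll_g_fun lepoll_Pow_self lepoll_trans by blast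
  then show ?thesis using lang_card_leD(1)[OF \<tau>] by (meson infinite_le_lepoll lepoll_trans)
qed

lemma is_card_daleth_F: "is_card (daleth F \<alpha>)"
  using is_card_daleth[OF univ] ER unfolding combinatorial_ER_def by blast

lemma daleth_less_f_fun: "\<zeta> < height \<Longrightarrow> daleth F \<zeta> < f_fun K F \<mu>"
  unfolding f_fun_def using daleth_strict_mono[OF univ growth] by blast

lemma tuple_in_image:
  assumes "is_card \<alpha>" "\<alpha> < f_fun K F \<mu>" "le K J (I \<alpha>)" "set a \<subseteq> univ J"
  shows "tuple_in (all_structs \<tau>) (M \<alpha>) (map (f \<alpha>) a)"
proof -
  have "univ J \<subseteq> univ (I \<alpha>)"
    using assms(3) K_leD by blast
  then have "f \<alpha> ` set a \<subseteq> univ (M \<alpha>)" using assms(4) f[OF assms(1,2)] by blast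
  then show ?thesis using M[OF assms(1,2)] unfolding tuple_in_def all_structs_def by simp
qed

lemma tp_image_in_types:
  assumes "is_card \<alpha>" "\<alpha> < f_fun K F \<mu>" "le K J (I \<alpha>)" "set a \<subseteq> univ J"
  shows "tp (all_structs \<tau>) (map (f \<alpha>) a) (M \<alpha>) \<in> types (all_structs \<tau>) (length a)"
  using tuple_in_image[OF assms] unfolding types_def by fastforce

text \<open>
  Bigness realizes the type in \<open>J\<close> by some tuple, and this tuple is automatically increasing.
\<close>

lemma inc_type_realized:
  assumes "J \<in> big (daleth F \<zeta>)" "le K J N" "p \<in> inc_types K lt n"
  obtains a where "increasing lt J a" "length a = n" "tp K a N = p" "tuple_in K J a"
proof -
  have "aleph0 \<le> daleth F \<zeta>"
    using daleth_mono[OF univ growth, of ozero \<zeta>] by (simp add: daleth_ozero)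
  then obtain a where a: "realizes K J a p"
    using big_card_realizes is_card_daleth_F assms(1,3) inc_types_subset[OF ord] by blast
  then show thesis
    using that realizes_inc_type[OF ord assms(3) a] tp_le[OF ordered_class_refines[OF ord] assms(2)]
    unfolding realizes_def by metis
qed

text \<open>
  The substructure at \<open>\<zeta>\<close> is cut out of the old member at \<open>\<zeta>' = \<eta> + 1\<close>, where \<open>\<eta> \<ge> \<zeta>\<close> is large enough
  for \<open>\<daleth>\<^sup>F\<^sub>\<eta>\<close> to exceed the number \<open>2\<^sup>\<mu>\<close> of colours: bigness at \<open>\<eta> + 1\<close> includes bigness
  \<open>F(\<daleth>\<^sup>F\<^sub>\<eta>, n)\<close>, from which the partition relation returns a \<open>\<daleth>\<^sup>F\<^sub>\<eta>\<close>-big structure.  The map \<open>\<Phi>\<close> is cut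
  down to the increasing \<open>n\<close>-types so that there are few possibilities for it.
\<close>

lemma homogenise_member:
  assumes S: "large_family S" and \<zeta>: "\<zeta> < height"
  obtains J \<alpha> \<Phi> \<zeta>' where "is_card \<alpha>" "daleth F \<zeta> \<le> \<alpha>" "\<alpha> < f_fun K F \<mu>"
    "J \<in> big (daleth F \<zeta>)" "le K J (I \<alpha>)"
    "\<zeta>' < height" "\<alpha> = snd (S \<zeta>')" "le K J (fst (S \<zeta>'))"
    "\<forall>a. increasing lt J a \<and> length a = n \<longrightarrow>
       tp (all_structs \<tau>) (map (f \<alpha>) a) (M \<alpha>) = \<Phi> (tp K a (I \<alpha>))"
    "\<Phi> \<in> inc_types K lt n \<rightarrow>\<^sub>E types (all_structs \<tau>) n"
proof -
  let ?T = "types (all_structs \<tau>) n"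
  define \<kappa> :: 'u where "\<kappa> = crd (Pow {..<\<mu>})"
  have \<kappa>: "Pow {..<\<mu>} \<lesssim> {..<\<kappa>}" "is_card \<kappa>" "\<kappa> \<le> g_fun K \<mu>"
    unfolding \<kappa>_def using Pow_lepoll_g_fun by (rule lepoll_crd is_card_crd crd_le)+
  have "{..<\<kappa>} \<noteq> {}" using \<kappa>(1) by (metis Pow_not_empty lepoll_empty_iff_empty)
  define \<eta> where "\<eta> = max \<zeta> (osuc \<kappa>)"
  have "\<kappa> < height" using \<kappa>(3) less_csucc[OF univ] by (meson le_less_trans)
  then have "\<eta> < height"
    using \<zeta> osuc_less_csucc[OF univ infinite_g_fun] unfolding \<eta>_def by simp
  then have \<eta>: "osuc \<eta> < height" using osuc_less_csucc[OF univ infinite_g_fun] by blast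
  have "\<kappa> < osuc \<kappa>" using less_osuc[OF univ] .
  also have "\<dots> \<le> daleth F \<eta>"
    using le_daleth[OF univ growth, of \<eta>] unfolding \<eta>_def by (meson max.cobounded2 order_trans)
  finally have "\<kappa> < daleth F \<eta>" .
  then have arrow: "arrows K lt big (F (daleth F \<eta>) n) (daleth F \<eta>) n \<kappa>"
    using ER \<kappa>(2) is_card_daleth_F unfolding combinatorial_ER_def by blast
  obtain J \<alpha> where J\<alpha>: "S (osuc \<eta>) = (J, \<alpha>)" by fastforce
  then have \<alpha>: "is_card \<alpha>" "daleth F (osuc \<eta>) \<le> \<alpha>" "\<alpha> < f_fun K F \<mu>"
    and J: "J \<in> big (daleth F (osuc \<eta>))" "le K J (I \<alpha>)"
    using S \<eta> unfolding large_family_def by fastforce+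
  have "is_card (F (daleth F \<eta>) n)" using ER is_card_daleth_F unfolding combinatorial_ER_def by blast
  then have J_big: "J \<in> big (F (daleth F \<eta>) n)"
    using bigness_mono[OF big abstract] is_card_daleth_F le_daleth_osuc[OF univ] J(1) by blast
  have J_mem: "J \<in> mem K" using J(2) K_leD by blast
  have T: "?T \<lesssim> {..<\<kappa>}" using types_all_structs_lepoll[OF \<tau>] \<kappa>(1) by (rule lepoll_trans)
  have colour: "tp (all_structs \<tau>) (map (f \<alpha>) a) (M \<alpha>) \<in> ?T"
    if "increasing lt J a" "length a = n" for a
    using tp_image_in_types[OF \<alpha>(1,3) J(2)] that unfolding increasing_def by blast
  obtain J0 \<Phi> where J0: "J0 \<in> big (daleth F \<eta>)" "le K J0 J"
    and \<Phi>: "\<forall>a. increasing lt J0 a \<and> length a = n \<longrightarrow>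
      tp (all_structs \<tau>) (map (f \<alpha>) a) (M \<alpha>) = \<Phi> (tp K a J)"
    using homogenise[OF ord arrow J_big J_mem T \<open>{..<\<kappa>} \<noteq> {}\<close>,
        of "\<lambda>a. tp (all_structs \<tau>) (map (f \<alpha>) a) (M \<alpha>)"] colour by blast
  have "\<zeta> \<le> \<eta>" unfolding \<eta>_def by simp
  then have big_\<zeta>: "J0 \<in> big (daleth F \<zeta>)"
    using bigness_mono[OF big abstract] is_card_daleth_F daleth_mono[OF univ growth] J0(1) by blast
  have J0_I: "le K J0 (I \<alpha>)" using J0(2) J(2) K_le_trans by blast
  have le_\<alpha>: "daleth F \<zeta> \<le> \<alpha>"
    using \<open>\<zeta> \<le> \<eta>\<close> \<alpha>(2) daleth_mono[OF univ growth, of \<zeta> "osuc \<eta>"] less_osuc[OF univ, of \<eta>] by force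
  have \<Phi>_I: "tp (all_structs \<tau>) (map (f \<alpha>) a) (M \<alpha>) = \<Phi> (tp K a (I \<alpha>))"
    if a: "increasing lt J0 a" "length a = n" for a
  proof -
    have "set a \<subseteq> univ J0" using a(1) unfolding increasing_def by blast
    moreover have "J0 \<in> mem K" using J0(2) K_leD by blast
    ultimately have "tuple_in K J0 a" unfolding tuple_in_def by simp
    then have "tuple_in K J a" using tuple_in_le[OF ordered_class_refines[OF ord] J0(2)] by blast
    then have "tp K a J = tp K a (I \<alpha>)" using tp_le[OF ordered_class_refines[OF ord] J(2)] by blast
    then show ?thesis using \<Phi> a by simp
  qed
  \<comment> \<open>All increasing types are realized in \<open>J0\<close>, so every value of \<open>\<Phi>\<close> on them is a colour.\<close>
  define \<Psi> where "\<Psi> = restrict \<Phi> (inc_types K lt n)"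
  have \<Psi>: "\<Psi> p = \<Phi> p" if "p \<in> inc_types K lt n" for p using that unfolding \<Psi>_def by simp
  have "\<Psi> \<in> inc_types K lt n \<rightarrow>\<^sub>E ?T"
    unfolding \<Psi>_def
  proof (rule restrict_PiE_iff[THEN iffD2], rule ballI)
    fix p assume "p \<in> inc_types K lt n"
    then obtain a where "increasing lt J0 a" "length a = n" "tp K a (I \<alpha>) = p"
      using inc_type_realized[OF big_\<zeta> J0_I] by metis
    then show "\<Phi> p \<in> ?T"
      using \<Phi>_I tp_image_in_types[OF \<alpha>(1,3) J0_I, of a] unfolding increasing_def by metis
  qed
  moreover have "\<forall>a. increasing lt J0 a \<and> length a = n \<longrightarrow>
       tp (all_structs \<tau>) (map (f \<alpha>) a) (M \<alpha>) = \<Psi> (tp K a (I \<alpha>))"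
  proof (intro allI impI)
    fix a assume a: "increasing lt J0 a \<and> length a = n"
    then have "increasing lt (I \<alpha>) a"
      using increasing_le_iff[OF ord J0_I] unfolding increasing_def by blast
    moreover have "I \<alpha> \<in> mem K" using J0_I K_leD by blast
    ultimately have "tp K a (I \<alpha>) \<in> inc_types K lt n" using tp_in_inc_types[OF ord] a by blast
    then show "tp (all_structs \<tau>) (map (f \<alpha>) a) (M \<alpha>) = \<Psi> (tp K a (I \<alpha>))"
      using \<Psi> \<Phi>_I a by simp
  qed
  ultimately show thesis using that \<alpha>(1,3) le_\<alpha> big_\<zeta> J0_I \<eta> J\<alpha> J0(2) by (metis fst_conv snd_conv)
qed

text \<open>
  The pigeonhole step: at most \<open>g\<close> maps can arise from the members, so one of them serves
  unboundedly many indices \<open>r \<zeta> \<ge> \<zeta>\<close>, and bigness is preserved when the index is lowered to \<open>\<zeta>\<close>.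
\<close>

lemma homogenise_family:
  assumes S: "large_family S"
  shows "\<exists>S' \<Phi>. large_family S' \<and> refines_family S' S \<and> homogeneous_family n \<Phi> S'"
proof -
  have "\<forall>\<zeta>. \<exists>J \<alpha> \<Phi>. \<zeta> < height \<longrightarrow>
    is_card \<alpha> \<and> daleth F \<zeta> \<le> \<alpha> \<and> \<alpha> < f_fun K F \<mu> \<and> J \<in> big (daleth F \<zeta>) \<and> le K J (I \<alpha>) \<and>
    (\<exists>\<zeta>'<height. \<alpha> = snd (S \<zeta>') \<and> le K J (fst (S \<zeta>'))) \<and>
    (\<forall>a. increasing lt J a \<and> length a = n \<longrightarrow>
       tp (all_structs \<tau>) (map (f \<alpha>) a) (M \<alpha>) = \<Phi> (tp K a (I \<alpha>))) \<and>
    \<Phi> \<in> inc_types K lt n \<rightarrow>\<^sub>E types (all_structs \<tau>) n"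
    using homogenise_member[OF S, of _ n] by (metis (no_types, lifting))
  then obtain J \<alpha> \<Phi> where *: "\<And>\<zeta>. \<zeta> < height \<Longrightarrow>
    is_card (\<alpha> \<zeta>) \<and> daleth F \<zeta> \<le> \<alpha> \<zeta> \<and> \<alpha> \<zeta> < f_fun K F \<mu> \<and> J \<zeta> \<in> big (daleth F \<zeta>) \<and>
    le K (J \<zeta>) (I (\<alpha> \<zeta>)) \<and>
    (\<exists>\<zeta>'<height. \<alpha> \<zeta> = snd (S \<zeta>') \<and> le K (J \<zeta>) (fst (S \<zeta>'))) \<and>
    (\<forall>a. increasing lt (J \<zeta>) a \<and> length a = n \<longrightarrow>
       tp (all_structs \<tau>) (map (f (\<alpha> \<zeta>)) a) (M (\<alpha> \<zeta>)) = \<Phi> \<zeta> (tp K a (I (\<alpha> \<zeta>)))) \<and>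
    \<Phi> \<zeta> \<in> inc_types K lt n \<rightarrow>\<^sub>E types (all_structs \<tau>) n"
    by metis
  have "\<Phi> ` {..<height} \<lesssim> (inc_types K lt n \<rightarrow>\<^sub>E types (all_structs \<tau>) n)"
    by (intro subset_imp_lepoll image_subsetI) (use * in blast)
  also have "\<dots> \<lesssim> Pow ({..<\<mu>} \<times> inc_types K lt n)"
    using types_all_structs_lepoll[OF \<tau>] by (rule PiE_lepoll_Pow_Times)
  also have "\<dots> \<lesssim> Pow ({..<\<mu>} \<times> types K n)"
    using inc_types_subset[OF ord] by (intro subset_imp_lepoll) blast
  also have "\<dots> \<lesssim> {..<g_fun K \<mu>}" by (rule Pow_Times_types_lepoll_g_fun)
  finally obtain \<Psi> where "\<forall>\<zeta><height. \<exists>\<zeta>'. \<zeta> \<le> \<zeta>' \<and> \<zeta>' < height \<and> \<Phi> \<zeta>' = \<Psi>"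
    using unbounded_fibre[OF univ infinite_g_fun] by blast
  then obtain r where r: "\<And>\<zeta>. \<zeta> < height \<Longrightarrow> \<zeta> \<le> r \<zeta> \<and> r \<zeta> < height \<and> \<Phi> (r \<zeta>) = \<Psi>"
    by metis
  define S' where "S' \<zeta> = (J (r \<zeta>), \<alpha> (r \<zeta>))" for \<zeta>
  have "large_family S'"
    unfolding large_family_def S'_def prod.case
  proof (intro allI impI)
    fix \<zeta> assume "\<zeta> < height"
    note r = r[OF this]
    have "daleth F \<zeta> \<le> daleth F (r \<zeta>)" using daleth_mono[OF univ growth] r by blast
    moreover from this have "J (r \<zeta>) \<in> big (daleth F \<zeta>)"
      using bigness_mono[OF big abstract is_card_daleth_F is_card_daleth_F] *[of "r \<zeta>"] r by blast
    ultimately show "is_card (\<alpha> (r \<zeta>)) \<and> daleth F \<zeta> \<le> \<alpha> (r \<zeta>) \<and> \<alpha> (r \<zeta>) < f_fun K F \<mu> \<and>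
      J (r \<zeta>) \<in> big (daleth F \<zeta>) \<and> le K (J (r \<zeta>)) (I (\<alpha> (r \<zeta>)))"
      using *[of "r \<zeta>"] r by (meson order_trans)
  qed
  moreover have "refines_family S' S"
    unfolding refines_family_def S'_def using * r by fastforce
  moreover have "homogeneous_family n \<Psi> S'"
    unfolding homogeneous_family_def S'_def prod.case using * r by metis
  ultimately show ?thesis by blast
qed

text \<open>
  Homogeneity passes down because the new members lie inside old ones and types are computed in the
  same ambient structure \<open>I \<alpha>\<close>.
\<close>

lemma homogeneous_family_refine:
  assumes "refines_family S' S" "homogeneous_family n \<Phi> S"
  shows "homogeneous_family n \<Phi> S'"
  unfolding homogeneous_family_def
proof (intro allI impI, clarsimp)
  fix \<zeta> J \<alpha> a
  assume "\<zeta> < height" "S' \<zeta> = (J, \<alpha>)" and a: "increasing lt J a" "n = length a"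
  then obtain \<zeta>' where \<zeta>': "\<zeta>' < height" "snd (S \<zeta>') = \<alpha>" "le K J (fst (S \<zeta>'))"
    using assms(1) unfolding refines_family_def by fastforce
  then have "increasing lt (fst (S \<zeta>')) a"
    using a(1) increasing_le_iff[OF ord] unfolding increasing_def by blast
  then show "tp (all_structs \<tau>) (map (f \<alpha>) a) (M \<alpha>) = \<Phi> (tp K a (I \<alpha>))"
    using assms(2) \<zeta>'(1,2) a(2) unfolding homogeneous_family_def by (fastforce split: prod.splits)
qed

lemma homogeneous_family_sequence:
  obtains S \<Phi> where "\<And>n. large_family (S n)" "\<And>n m. n < m \<Longrightarrow> homogeneous_family n (\<Phi> n) (S m)"
proof -
  have "large_family (\<lambda>\<zeta>. (I (daleth F \<zeta>), daleth F \<zeta>))"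
    unfolding large_family_def prod.case
  proof (intro allI impI)
    fix \<zeta> assume "\<zeta> < height"
    note \<alpha> = is_card_daleth_F daleth_less_f_fun[OF this]
    have "I (daleth F \<zeta>) \<in> mem K" using I[OF \<alpha>] big \<alpha>(1) unfolding bigness_def by blast
    then have "le K (I (daleth F \<zeta>)) (I (daleth F \<zeta>))"
      using ordered_class_refines[OF ord] unfolding refines_substructure_def by blast
    then show "is_card (daleth F \<zeta>) \<and> daleth F \<zeta> \<le> daleth F \<zeta> \<and> daleth F \<zeta> < f_fun K F \<mu> \<and>
      I (daleth F \<zeta>) \<in> big (daleth F \<zeta>) \<and> le K (I (daleth F \<zeta>)) (I (daleth F \<zeta>))"
      using \<alpha> I[OF \<alpha>] by simp
  qed
  then have "\<exists>S. \<forall>n. large_family (S n) \<and>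
      (refines_family (S (Suc n)) (S n) \<and> (\<exists>\<Phi>. homogeneous_family n \<Phi> (S (Suc n))))"
    using homogenise_family by (intro dependent_nat_choice) blast+
  then obtain S \<Phi> where S: "\<And>n. large_family (S n)" "\<And>n. refines_family (S (Suc n)) (S n)"
    and \<Phi>: "\<And>n. homogeneous_family n (\<Phi> n) (S (Suc n))"
    by metis
  have "homogeneous_family n (\<Phi> n) (S m)" if "Suc n \<le> m" for n m
    using that by (induction m rule: dec_induct) (auto intro: \<Phi> homogeneous_family_refine S(2))
  then show thesis using that S(1) by (metis Suc_leI)
qed

section \<open>The blueprint\<close>

lemma blueprint_exists:
  "\<exists>\<Phi>. blueprint K lt \<tau> \<Phi> \<and>
     (\<forall>n. \<forall>p\<in>inc_types K lt n. \<forall>\<beta><f_fun K F \<mu>. is_card \<beta> \<longrightarrow>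
        (\<exists>\<alpha>. is_card \<alpha> \<and> \<beta> \<le> \<alpha> \<and> \<alpha> < f_fun K F \<mu> \<and>
           (\<exists>a. increasing lt (I \<alpha>) a \<and> realizes K (I \<alpha>) a p \<and>
                tp (all_structs \<tau>) (map (f \<alpha>) a) (M \<alpha>) = \<Phi> p)))"
proof -
  obtain S \<Psi> where S: "\<And>n. large_family (S n)"
    and hom: "\<And>n m. n < m \<Longrightarrow> homogeneous_family n (\<Psi> n) (S m)"
    using homogeneous_family_sequence by blast
  define \<Phi> where "\<Phi> p = \<Psi> (THE n. p \<in> inc_types K lt n) p" for p
  have \<Phi>: "\<Phi> p = \<Psi> n p" if "p \<in> inc_types K lt n" for n p
    using inc_types_unique[OF ord _ that] that unfolding \<Phi>_def by (metis the_equality)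
  \<comment> \<open>The family after stage \<open>n\<close> is homogeneous for all lengths up to \<open>n\<close>, so one tuple realizing \<open>p\<close>
    handles all subtypes of \<open>p\<close> at once.\<close>
  have realize: "\<exists>\<alpha> a. is_card \<alpha> \<and> daleth F \<zeta> \<le> \<alpha> \<and> \<alpha> < f_fun K F \<mu> \<and>
      increasing lt (I \<alpha>) a \<and> length a = n \<and> realizes K (I \<alpha>) a p \<and>
      tuple_in (all_structs \<tau>) (M \<alpha>) (map (f \<alpha>) a) \<and>
      (\<forall>s. tp (all_structs \<tau>) (map (f \<alpha>) (nths a s)) (M \<alpha>) = \<Phi> (tp K (nths a s) (I \<alpha>)))"
    if \<zeta>: "\<zeta> < height" and p: "p \<in> inc_types K lt n" for \<zeta> n p
  proof -
    obtain J \<alpha> where J\<alpha>: "S (Suc n) \<zeta> = (J, \<alpha>)" by fastforce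
    then have \<alpha>: "is_card \<alpha>" "daleth F \<zeta> \<le> \<alpha>" "\<alpha> < f_fun K F \<mu>"
      and J: "J \<in> big (daleth F \<zeta>)" "le K J (I \<alpha>)"
      using S[of "Suc n"] \<zeta> unfolding large_family_def by fastforce+
    obtain a where a: "increasing lt J a" "length a = n" "tp K a (I \<alpha>) = p" "tuple_in K J a"
      using inc_type_realized[OF J p] .
    have I_mem: "I \<alpha> \<in> mem K" using J(2) K_leD by blast
    have inc: "increasing lt (I \<alpha>) b" if "increasing lt J b" for b
      using that increasing_le_iff[OF ord J(2)] unfolding increasing_def by blast
    have "realizes K (I \<alpha>) a p"
      using a(3,4) tuple_in_le[OF ordered_class_refines[OF ord] J(2)] unfolding realizes_def by blast
    moreover have "tuple_in (all_structs \<tau>) (M \<alpha>) (map (f \<alpha>) a)"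
      using tuple_in_image[OF \<alpha>(1,3) J(2)] a(4) unfolding tuple_in_def by blast
    moreover have "tp (all_structs \<tau>) (map (f \<alpha>) (nths a s)) (M \<alpha>) = \<Phi> (tp K (nths a s) (I \<alpha>))" for s
    proof -
      have b: "increasing lt J (nths a s)" using increasing_nths[OF ord a(1)] .
      have "card {i. i < n \<and> i \<in> s} \<le> card {..<n}" by (intro card_mono) auto
      then have "length (nths a s) < Suc n" using a(2) by (simp add: length_nths)
      then have "tp (all_structs \<tau>) (map (f \<alpha>) (nths a s)) (M \<alpha>)
          = \<Psi> (length (nths a s)) (tp K (nths a s) (I \<alpha>))"
        using hom[of "length (nths a s)" "Suc n"] \<zeta> b J\<alpha> unfolding homogeneous_family_def by auto
      also have "\<dots> = \<Phi> (tp K (nths a s) (I \<alpha>))"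
        using \<Phi> tp_in_inc_types[OF ord I_mem inc[OF b]] by simp
      finally show ?thesis .
    qed
    ultimately show ?thesis using \<alpha> inc[OF a(1)] a(2) by blast
  qed
  have nths_all: "nths a {..<length a} = a" for a :: "'u list"
    by (metis nths_upt_eq_take take_all_iff order_refl lessThan_atLeast0)
  have "blueprint K lt \<tau> \<Phi>"
    unfolding blueprint_def
  proof (intro allI ballI)
    fix n p assume p: "p \<in> inc_types K lt n"
    have "ozero < height" using less_csucc[OF univ] ozero_le by (meson le_less_trans)
    from realize[OF this p] obtain \<alpha> a where a: "length a = n" "realizes K (I \<alpha>) a p"
      "tuple_in (all_structs \<tau>) (M \<alpha>) (map (f \<alpha>) a)"
      and sub: "\<And>s. tp (all_structs \<tau>) (map (f \<alpha>) (nths a s)) (M \<alpha>) = \<Phi> (tp K (nths a s) (I \<alpha>))"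
      by blast
    have p_eq: "p = tp K a (I \<alpha>)" "tuple_in K (I \<alpha>) a" using a(2) unfolding realizes_def by auto
    have \<Phi>p: "\<Phi> p = tp (all_structs \<tau>) (map (f \<alpha>) a) (M \<alpha>)"
      using sub[of "{..<length a}"] p_eq(1) nths_all by simp
    then have "\<Phi> p \<in> types (all_structs \<tau>) n"
      unfolding types_def using a by fastforce
    moreover have "\<Phi> (subtype K p s) = subtype (all_structs \<tau>) (\<Phi> p) s" for s
      using sub[of s] subtype_tp[OF ordered_class_refines[OF ord] p_eq(2)]
        subtype_tp[OF refines_substructure_all_structs a(3)] \<Phi>p p_eq(1) by (simp add: nths_map)
    ultimately show "\<Phi> p \<in> types (all_structs \<tau>) n \<and>
        (\<forall>s\<subseteq>{..<n}. \<Phi> (subtype K p s) = subtype (all_structs \<tau>) (\<Phi> p) s)" by blast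
  qed
  moreover have "\<exists>\<alpha>. is_card \<alpha> \<and> \<beta> \<le> \<alpha> \<and> \<alpha> < f_fun K F \<mu> \<and>
      (\<exists>a. increasing lt (I \<alpha>) a \<and> realizes K (I \<alpha>) a p \<and>
           tp (all_structs \<tau>) (map (f \<alpha>) a) (M \<alpha>) = \<Phi> p)"
    if p: "p \<in> inc_types K lt n" and \<beta>: "\<beta> < f_fun K F \<mu>" for n p \<beta>
  proof -
    obtain \<zeta> where \<zeta>: "\<zeta> < height" "\<beta> < daleth F \<zeta>"
      using less_daleth_csucc[OF univ growth infinite_g_fun] \<beta> unfolding f_fun_def by blast
    from realize[OF \<zeta>(1) p] obtain \<alpha> a where "is_card \<alpha>" "daleth F \<zeta> \<le> \<alpha>" "\<alpha> < f_fun K F \<mu>"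
      "increasing lt (I \<alpha>) a" "realizes K (I \<alpha>) a p"
      and sub: "\<And>s. tp (all_structs \<tau>) (map (f \<alpha>) (nths a s)) (M \<alpha>) = \<Phi> (tp K (nths a s) (I \<alpha>))"
      by blast
    moreover from this have "tp (all_structs \<tau>) (map (f \<alpha>) a) (M \<alpha>) = \<Phi> p"
      using sub[of "{..<length a}"] nths_all unfolding realizes_def by simp
    ultimately show ?thesis using \<zeta>(2) by (meson less_imp_le order_trans)
  qed
  ultimately show ?thesis by blast
qed

end

end

theorem theorem4p3:
  fixes K :: "'u::wellorder aclass"
    and lt :: "'u \<times> nat"
    and big :: "'u \<Rightarrow> 'u struct set"
    and F :: "'u \<Rightarrow> nat \<Rightarrow> 'u"
  assumes univ: "set_universe TYPE('u)"
    and ord: "ordered_class K lt"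
    and big: "bigness K big"
    and ER: "combinatorial_ER K lt big F"
    and growth: "\<And>\<alpha>. daleth F \<alpha> < daleth F (osuc \<alpha>)"
  shows "\<forall>\<mu>. is_card \<mu> \<longrightarrow> cofinally_ER K lt big \<mu> (f_fun K F \<mu>)"
  unfolding cofinally_ER_def
proof (intro allI impI, elim conjE)
  fix \<mu> \<tau> M I f
  assume "lang_card_le \<tau> \<mu>" and *: "\<forall>\<alpha><f_fun K F \<mu>. is_card \<alpha> \<longrightarrow>
    is_struct \<tau> (M \<alpha>) \<and> I \<alpha> \<in> big \<alpha> \<and>
    inj_on (f \<alpha>) (univ (I \<alpha>)) \<and> f \<alpha> ` univ (I \<alpha>) \<subseteq> univ (M \<alpha>)"
  then show "\<exists>\<Phi>. blueprint K lt \<tau> \<Phi> \<and>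
     (\<forall>n. \<forall>p\<in>inc_types K lt n. \<forall>\<beta><f_fun K F \<mu>. is_card \<beta> \<longrightarrow>
        (\<exists>\<alpha>. is_card \<alpha> \<and> \<beta> \<le> \<alpha> \<and> \<alpha> < f_fun K F \<mu> \<and>
           (\<exists>a. increasing lt (I \<alpha>) a \<and> realizes K (I \<alpha>) a p \<and>
                tp (all_structs \<tau>) (map (f \<alpha>) a) (M \<alpha>) = \<Phi> p)))"
    by (intro blueprint_exists[OF univ ord big ER growth]) blast+
qed

end
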